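(* Let $N > 0$ and $0 \leqslant n_0 < \dots < n_{N-1}$ be integers, and for each integer $M > n_{N-1}$, let $\epsilon_M \in \{-1,0,+1\}$ be a sign. Suppose that whenever $\epsilon_{M_0} = -1$ for some $M_0 > n_{N-1}$, one has $\epsilon_M = +1$ for at least $N$ choices of $M > M_0$. Let $c_{n_0},\dots,c_{n_{N-1}}$ be positive reals. Then there exists a convergent power series $$f(x) = c_{n_0} x^{n_0} + c_{n_1} x^{n_1} + \dots + c_{n_{N-1}} x^{n_{N-1}} + \sum_{M > n_{N-1}} c_M x^M$$ on $(0,+\infty)$ (with real coefficients) that is an entrywise positivity preserver on $\mathbb{P}_N((0,+\infty))$, such that for each integer $M > n_{N-1}$, $c_M$ has the sign of $\epsilon_M$ (that is, $c_M$ is negative, zero, or positive according as $\epsilon_M=-1,0,+1$).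
   Context: For $I \subset \mathbb{C}$, $\mathbb{P}_N(I)$ denotes the set of positive semidefinite Hermitian $N\times N$ matrices all of whose entries lie in $I$. For a function $f$ on $I$ and a matrix $A=(a_{jk})$ with entries in $I$, $f[A] := (f(a_{jk}))$ is the entrywise application of $f$. The function $f$ is an entrywise positivity preserver on $\mathbb{P}_N(I)$ if $f[A]$ is positive semidefinite for every $A \in \mathbb{P}_N(I)$. *)

theory Defs
  imports Complex_Main "Jordan_Normal_Form.Schur_Decomposition"
begin

(* The order on complex numbers is the one of Complex_Order, so that 0 \<le> z says that z is real
   and nonnegative; (A *\<^sub>v v) \<bullet>c v is the Hermitian form v\<^sup>* A v. *)
definition psd_mat :: "nat \<Rightarrow> complex mat \<Rightarrow> bool" where
  "psd_mat N A \<longleftrightarrow> A \<in> carrier_mat N N \<and> mat_adjoint A = A \<and>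
     (\<forall>v \<in> carrier_vec N. 0 \<le> (A *\<^sub>v v) \<bullet>c v)"

definition psd_mats_on :: "nat \<Rightarrow> complex set \<Rightarrow> complex mat set" where
  "psd_mats_on N I = {A. psd_mat N A \<and> elements_mat A \<subseteq> I}"

(* f is total here, but only its values on I matter. *)
definition entrywise_positivity_preserver ::
    "nat \<Rightarrow> complex set \<Rightarrow> (complex \<Rightarrow> complex) \<Rightarrow> bool" where
  "entrywise_positivity_preserver N I f \<longleftrightarrow>
     (\<forall>A \<in> psd_mats_on N I. psd_mat N (map_mat f A))"

end

theory Submission
  imports Defs
begin

text \<open>
  A negative coefficient at $x^M$ is harmless if the matrix $A^{\circ M}$ of entrywise powers can be
  absorbed, up to a small factor, by the entrywise powers that carry positive coefficients. The key
  result (\<open>dominated_power\<close>) says that $N$ exponents below $M$ and $N$ exponents above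
  $M$ suffice: for arbitrary positive weights $c_e$ on such exponents there is
  $\delta > 0$ with $\delta A^{\circ M} \preceq \sum_e c_e A^{\circ e}$ for all positive
  semidefinite $N \times N$ matrices $A$ with positive entries. The exponents
  $n_0, \dots, n_{N-1}$ lie below $M$, and the hypothesis on the signs supplies $N$ exponents above it.
  If the negative exponents share out the available positive coefficients with weights $2^{-M-1}$,
  all of them can be absorbed simultaneously, and coefficients of size at most $1/m!$ make the
  series converge (\<open>sign_pattern_series\<close>).

  For a rank one matrix $A = u u^T$ the quadratic forms are squares,
  $v^T A^{\circ e} v = (\sum_i v_i u_i^e)^2$, so it is enough to write the monomial $x^M$ on the
  set of the $u_i$ as a combination of the monomials $x^e$ whose coefficients are bounded
  independently of the $u_i$ (\<open>bounded_interpolation\<close>). The points $u_i \le 1$ are paired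
  with exponents below $M$, the points $u_i > 1$ with exponents above $M$. The bound rests on
  Descartes' rule of signs. The difference of $x^M$ and its interpolant is a polynomial with one more
  term than it has prescribed positive roots, so its coefficients alternate in sign. Such sign
  information shows that adding a node together with an exponent on the far side of $M$ only decreases
  the absolute values of the coefficients on the near side
  (\<open>sparse_interpolant_add_node\<close>). This reduces the bound to the case in which all exponents lie on one side of $M$ and all points on one side of 1; the two sides
  are exchanged by $x \mapsto 1/x$, and on the lower one the coefficients are bounded because the cofactor of
  $\prod_u (x - u)$ has nonnegative coefficients (\<open>sparse_interpolant_top_bound\<close>).

  General matrices are reached by induction on $N$, following FitzGerald and Horn: if $\zeta\zeta^T$ is
  the rank one matrix with the same last row and column as $A$, then moving from $\zeta\zeta^T$ to
  $A$ along a segment changes the quadratic form at the rate given by the entrywise product of the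
  Schur complement $A - \zeta\zeta^T$, of size $N - 1$, with the entrywise derivative, to
  which the induction hypothesis applies.
\<close>

section \<open>Descartes' rule of signs\<close>

text \<open>
  \<open>alternates k p\<close> says that the coefficients of \<open>p\<close> change sign at least \<open>k\<close> times.
  Exhibiting the positions \<open>i\<close> where the signs alternate avoids counting changes in a list of
  coefficients with zeros; $\sigma$ only fixes the first sign.
\<close>

definition alternates :: "nat \<Rightarrow> real poly \<Rightarrow> bool" where
  "alternates k p \<longleftrightarrow> (\<exists>(\<sigma>::real) i. (\<forall>a b. a < b \<and> b \<le> k \<longrightarrow> i a < i b) \<and>
     (\<forall>j\<le>k. 0 < \<sigma> * (-1) ^ j * coeff p (i j)))"

(* Products with linear factors stay folded, so that their coefficients can be compared with those
   of the cofactor. *)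
declare mult_pCons_left [simp del]

lemma coeff_linear_mult_Suc:
  "coeff ([:- u, 1:] * p) (Suc m) = coeff p m - u * coeff (p :: real poly) (Suc m)"
  by (simp add: coeff_pCons mult_pCons_left)

lemma coeff_linear_mult_0: "coeff ([:- u, 1:] * p) 0 = - u * coeff (p :: real poly) 0"
  by (simp add: mult_pCons_left)

text \<open>
  The coefficient of $(x - u) p$ at $m + 1$ is $p_m - u p_{m+1}$. Hence the first place after \<open>a\<close>
  where the sign $\tau$ is lost in \<open>p\<close> still carries it in the product.
\<close>

lemma linear_mult_descent:
  fixes p :: "real poly"
  assumes u: "u > 0" and a: "\<tau> * coeff p a > 0" and b: "a < b" "\<tau> * coeff p b \<le> 0"
  shows "\<exists>m. a < m \<and> m \<le> b \<and> \<tau> * coeff ([:- u, 1:] * p) m > 0"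
proof -
  define m where "m = (LEAST m. m > a \<and> \<tau> * coeff p m \<le> 0)"
  have m: "m > a" "\<tau> * coeff p m \<le> 0"
    using LeastI[of "\<lambda>m. m > a \<and> \<tau> * coeff p m \<le> 0" b] b unfolding m_def by auto
  have mb: "m \<le> b" unfolding m_def using b by (intro Least_le) auto
  obtain l where l: "m = Suc l" using m(1) by (cases m) auto
  have pos: "\<tau> * coeff p l > 0"
  proof (cases "l = a")
    case False
    then have "l > a" using m(1) l by simp
    moreover have "\<not> (l > a \<and> \<tau> * coeff p l \<le> 0)"
      using not_less_Least[of l "\<lambda>m. m > a \<and> \<tau> * coeff p m \<le> 0"] l unfolding m_def by simp
    ultimately show ?thesis by simp
  qed (use a in simp)
  have "u * (\<tau> * coeff p m) \<le> 0" using u m(2) by (simp add: mult_nonneg_nonpos)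
  then have "\<tau> * coeff ([:- u, 1:] * p) m > 0"
    using pos unfolding l coeff_linear_mult_Suc by (simp add: algebra_simps)
  then show ?thesis using m mb by blast
qed

text \<open>
  Dually, at the first place where the sign $\tau$ appears in \<open>p\<close> the product has the opposite
  sign. This is the additional sign change in Descartes' rule.
\<close>

lemma linear_mult_ascent:
  fixes p :: "real poly"
  assumes u: "u > 0" and a: "\<tau> * coeff p a > 0"
  shows "\<exists>m. m \<le> a \<and> - \<tau> * coeff ([:- u, 1:] * p) m > 0"
proof -
  define m where "m = (LEAST m. \<tau> * coeff p m > 0)"
  have m: "\<tau> * coeff p m > 0"
    using LeastI[of "\<lambda>m. \<tau> * coeff p m > 0" a] a unfolding m_def by auto
  have mb: "m \<le> a" unfolding m_def using a by (intro Least_le) auto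
  have u': "u * (\<tau> * coeff p m) > 0" using u m by simp
  have "- \<tau> * coeff ([:- u, 1:] * p) m > 0"
  proof (cases m)
    case 0
    then show ?thesis using u' unfolding 0 coeff_linear_mult_0 by (simp add: algebra_simps)
  next
    case (Suc l)
    have "\<tau> * coeff p l \<le> 0"
      using not_less_Least[of l "\<lambda>m. \<tau> * coeff p m > 0"] Suc unfolding m_def by simp
    then show ?thesis using u' unfolding Suc coeff_linear_mult_Suc by (simp add: algebra_simps)
  qed
  then show ?thesis using mb by blast
qed

lemma alternates_linear_mult:
  assumes "alternates k p" and u: "u > 0"
  shows "alternates (Suc k) ([:- u, 1:] * p)"
proof -
  obtain \<sigma> i where mono: "\<And>a b. a < b \<Longrightarrow> b \<le> k \<Longrightarrow> i a < i b"
    and sg: "\<And>j. j \<le> k \<Longrightarrow> 0 < \<sigma> * (-1) ^ j * coeff p (i j)"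
    using assms(1) unfolding alternates_def by blast
  have "\<exists>m. i j < m \<and> (j < k \<longrightarrow> m \<le> i (Suc j)) \<and>
          \<sigma> * (-1) ^ j * coeff ([:- u, 1:] * p) m > 0" if j: "j \<le> k" for j
  proof (cases "j < k")
    case True
    have "\<sigma> * (-1) ^ j * coeff p (i (Suc j)) \<le> 0" using sg[of "Suc j"] True by simp
    then show ?thesis
      using linear_mult_descent[OF u sg[OF j] mono[of j "Suc j"]] True by auto
  next
    case False
    have "coeff p (Suc (max (i j) (degree p))) = 0" by (simp add: coeff_eq_0)
    then show ?thesis
      using linear_mult_descent[OF u sg[OF j], of "Suc (max (i j) (degree p))"] False by fastforce
  qed
  then obtain m where m: "\<And>j. j \<le> k \<Longrightarrow> i j < m j"
      "\<And>j. j < k \<Longrightarrow> m j \<le> i (Suc j)"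
      "\<And>j. j \<le> k \<Longrightarrow> \<sigma> * (-1) ^ j * coeff ([:- u, 1:] * p) (m j) > 0"
    by (metis less_imp_le)
  obtain m0 where m0: "m0 \<le> i 0" "- \<sigma> * coeff ([:- u, 1:] * p) m0 > 0"
    using linear_mult_ascent[OF u, of \<sigma> p "i 0"] sg[of 0] by auto
  \<comment> \<open>The new first position precedes the old ones, and the others lie between consecutive old ones.\<close>
  define i' where "i' = case_nat m0 m"
  have "i' a < i' b" if ab: "a < b" "b \<le> Suc k" for a b
  proof -
    obtain b' where b': "b = Suc b'" using ab by (cases b) auto
    have mb: "i a' \<le> i b'" if "a' \<le> b'" for a'
      using mono[of a' b'] that ab b' by (cases "a' = b'") auto
    show ?thesis
    proof (cases a)
      case 0
      then show ?thesis using m0 mb[of 0] m(1)[of b'] ab b' by (simp add: i'_def)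
    next
      case (Suc a')
      then show ?thesis using m(2)[of a'] mb[of "Suc a'"] m(1)[of b'] ab b' by (simp add: i'_def)
    qed
  qed
  moreover have "0 < - \<sigma> * (-1) ^ j * coeff ([:- u, 1:] * p) (i' j)" if "j \<le> Suc k" for j
    using that m0 m(3) by (cases j) (auto simp: i'_def)
  ultimately show ?thesis unfolding alternates_def by blast
qed

lemma alternates_roots_mult:
  assumes "finite U" "\<And>u. u \<in> U \<Longrightarrow> u > 0" "alternates k p"
  shows "alternates (k + card U) ((\<Prod>u\<in>U. [:- u, 1:]) * p)"
  using assms
proof (induction U rule: finite_induct)
  case (insert u U)
  then show ?case
    using alternates_linear_mult[of "k + card U" "(\<Prod>u\<in>U. [:- u, 1:]) * p" u]
    by (simp add: mult.assoc del: mult_pCons_left)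
qed simp

lemma roots_factor:
  fixes q :: "real poly"
  assumes "finite U" "\<And>u. u \<in> U \<Longrightarrow> poly q u = 0"
  obtains s where "q = (\<Prod>u\<in>U. [:- u, 1:]) * s"
  using assms
proof (induction U arbitrary: q thesis rule: finite_induct)
  case (insert u U)
  obtain q' where q': "q = [:- u, 1:] * q'"
    using insert.prems(2)[of u] by (auto simp: poly_eq_0_iff_dvd elim!: dvdE)
  have "poly q' v = 0" if "v \<in> U" for v
    using insert.prems(2)[of v] that insert.hyps q' by auto
  then obtain s where "q' = (\<Prod>u\<in>U. [:- u, 1:]) * s" using insert.IH by blast
  then show ?case using insert.prems(1)[of s] q' insert.hyps by (simp add: mult.assoc)
qed simp

text \<open>
  If there are no more possible exponents than alternation requires, then every one of them is a
  position of alternation, which determines the sign of every coefficient from its rank in \<open>T\<close>.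
\<close>

lemma alternates_card:
  assumes "alternates k p" "finite T" "\<And>i. coeff p i \<noteq> 0 \<Longrightarrow> i \<in> T"
  shows "Suc k \<le> card T"
    and "card T = Suc k \<Longrightarrow>
      \<exists>\<sigma>. \<forall>t\<in>T. 0 < \<sigma> * (-1) ^ card {s \<in> T. s < t} * coeff p t"
proof -
  obtain \<sigma> i where mono: "\<And>a b. a < b \<Longrightarrow> b \<le> k \<Longrightarrow> i a < i b"
    and sg: "\<And>j. j \<le> k \<Longrightarrow> 0 < \<sigma> * (-1) ^ j * coeff p (i j)"
    using assms(1) unfolding alternates_def by blast
  have inj: "inj_on i {..k}"
    by (rule linorder_inj_onI) (use mono in fastforce)+
  have sub: "i ` {..k} \<subseteq> T"
  proof
    fix t assume "t \<in> i ` {..k}"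
    then obtain j where "j \<le> k" "t = i j" by auto
    then show "t \<in> T" using sg[of j] assms(3)[of t] by (metis less_irrefl mult_zero_right)
  qed
  have c: "card (i ` {..k}) = Suc k" using inj by (simp add: card_image)
  show "Suc k \<le> card T" using card_mono[OF assms(2) sub] c by simp
  assume "card T = Suc k"
  then have T: "T = i ` {..k}" using card_subset_eq[OF assms(2) sub] c by simp
  have "0 < \<sigma> * (-1) ^ card {s \<in> T. s < t} * coeff p t" if "t \<in> T" for t
  proof -
    obtain j where j: "j \<le> k" "t = i j" using \<open>t \<in> T\<close> T by auto
    have "{s \<in> T. s < t} = i ` {..<j}"
    proof (intro Set.set_eqI iffI)
      fix s assume "s \<in> {s \<in> T. s < t}"
      then obtain l where l: "l \<le> k" "s = i l" "i l < i j" using T j by auto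
      then have "l < j" using mono[of j l] by (cases l j rule: linorder_cases) auto
      then show "s \<in> i ` {..<j}" using l by auto
    qed (use T j mono in auto)
    moreover have "inj_on i {..<j}" using inj by (rule inj_on_subset) (use j in auto)
    ultimately have "card {s \<in> T. s < t} = j" by (simp add: card_image)
    then show ?thesis using sg[of j] j by simp
  qed
  then show "\<exists>\<sigma>. \<forall>t\<in>T. 0 < \<sigma> * (-1) ^ card {s \<in> T. s < t} * coeff p t" by blast
qed

lemma alternates_0: "p \<noteq> 0 \<Longrightarrow> alternates 0 p"
proof -
  assume "p \<noteq> 0"
  then have "0 < lead_coeff p * (-1) ^ 0 * coeff p (degree p)"
    by (simp add: not_sum_power2_lt_zero) (metis leading_coeff_0_iff not_real_square_gt_zero)
  then show ?thesis unfolding alternates_def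
    by (intro exI[of _ "lead_coeff p"] exI[of _ "\<lambda>_. degree p"]) auto
qed

locale sparse_poly =
  fixes q :: "real poly" and T :: "nat set" and U :: "real set"
  assumes finT: "finite T" and finU: "finite U" and Upos: "u \<in> U \<Longrightarrow> u > 0"
    and supp: "coeff q i \<noteq> 0 \<Longrightarrow> i \<in> T" and root: "u \<in> U \<Longrightarrow> poly q u = 0"
begin

lemma many_terms:
  assumes "q \<noteq> 0" shows "card U < card T"
proof -
  obtain s where s: "q = (\<Prod>u\<in>U. [:- u, 1:]) * s" using roots_factor[OF finU root] by blast
  then have "alternates (0 + card U) q"
    using alternates_roots_mult[OF finU Upos alternates_0[of s]] assms by auto
  from alternates_card(1)[OF this finT supp] show ?thesis by simp
qed

lemma signs:
  assumes "q \<noteq> 0" "card T = Suc (card U)"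
  shows "\<exists>\<sigma>. \<forall>t\<in>T. 0 < \<sigma> * (-1) ^ card {s \<in> T. s < t} * coeff q t"
proof -
  obtain s where s: "q = (\<Prod>u\<in>U. [:- u, 1:]) * s" using roots_factor[OF finU root] by blast
  then have "alternates (0 + card U) q"
    using alternates_roots_mult[OF finU Upos alternates_0[of s]] assms by auto
  from alternates_card(2)[OF this finT supp] assms show ?thesis by simp
qed

text \<open>
  A sign change in the cofactor would add one to the sign changes forced by the roots, which already
  exhaust the available terms. So all coefficients of the cofactor have the same sign.
\<close>

lemma quotient_signs:
  assumes "q = (\<Prod>u\<in>U. [:- u, 1:]) * s" "card T = Suc (card U)"
  shows "0 \<le> coeff s a * coeff s b"
proof (rule ccontr)
  assume neg: "\<not> 0 \<le> coeff s a * coeff s b"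
  have *: False if "a < b" "coeff s a * coeff s b < 0" for a b
  proof -
    have "alternates 1 s" unfolding alternates_def
    proof (intro exI[of _ "coeff s a"] exI[of _ "case_nat a (\<lambda>_. b)"] conjI allI impI)
      fix x y :: nat assume "x < y \<and> y \<le> 1"
      then show "(case x of 0 \<Rightarrow> a | Suc _ \<Rightarrow> b) < (case y of 0 \<Rightarrow> a | Suc _ \<Rightarrow> b)"
        using that by (cases x; cases y) auto
    next
      fix j :: nat assume "j \<le> 1"
      then have "j = 0 \<or> j = 1" by auto
      moreover have "coeff s a \<noteq> 0" using that by auto
      then have "coeff s a * coeff s a > 0" by (metis not_real_square_gt_zero)
      ultimately show "0 < coeff s a * (-1) ^ j * coeff s (case j of 0 \<Rightarrow> a | Suc _ \<Rightarrow> b)"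
        using that by auto
    qed
    then have "alternates (1 + card U) q"
      using alternates_roots_mult[OF finU Upos \<open>alternates 1 s\<close>] assms(1) by simp
    from alternates_card(1)[OF this finT supp] assms(2) show False by simp
  qed
  have "a \<noteq> b" using neg by auto
  then show False using *[of a b] *[of b a] neg by (cases "a < b") (auto simp: mult.commute)
qed

end

section \<open>Interpolating a monomial by other monomials with bounded coefficients\<close>

text \<open>
  The remainder $q$ of an interpolation: on \<open>U\<close> the monomial $x^M$ agrees with $x^M - q$, which
  has exponents in \<open>T\<close> only.
\<close>

definition sparse_interpolant :: "nat set \<Rightarrow> real set \<Rightarrow> nat \<Rightarrow> real poly \<Rightarrow> bool" where
  "sparse_interpolant T U M q \<longleftrightarrow> coeff q M = 1 \<and>
     (\<forall>i. i \<notin> insert M T \<longrightarrow> coeff q i = 0) \<and> (\<forall>u\<in>U. poly q u = 0)"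

lemma poly_eq_sum_support:
  fixes q :: "real poly"
  assumes "finite S" "\<And>i. coeff q i \<noteq> 0 \<Longrightarrow> i \<in> S"
  shows "poly q x = (\<Sum>i\<in>S. coeff q i * x ^ i)"
proof -
  have "poly q x = (\<Sum>i\<in>{..degree q} \<inter> S. coeff q i * x ^ i)"
    unfolding poly_altdef using assms by (intro sum.mono_neutral_right) auto
  also have "\<dots> = (\<Sum>i\<in>S. coeff q i * x ^ i)"
    using assms by (intro sum.mono_neutral_left) (auto simp: coeff_eq_0 not_le)
  finally show ?thesis .
qed

lemma sparse_poly_eq_0:
  fixes q :: "real poly"
  assumes "finite T" "finite U" "U \<subseteq> {0<..}" "card T \<le> card U"
    "\<And>i. i \<notin> T \<Longrightarrow> coeff q i = 0" "\<And>u. u \<in> U \<Longrightarrow> poly q u = 0"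
  shows "q = 0"
proof -
  interpret sparse_poly q T U using assms by unfold_locales auto
  show ?thesis using many_terms assms(4) by force
qed

text \<open>
  Newton's scheme: correct the interpolant of $x^M$ on all but one node by a multiple of the
  interpolant of $x^t$ on these nodes. The latter does not vanish at the remaining node, because it has
  too few terms for a further root.
\<close>

lemma sparse_interpolant_exists:
  assumes "finite T" "finite U" "U \<subseteq> {0<..}" "card U = card T" "M \<notin> T"
  shows "\<exists>q. sparse_interpolant T U M q"
  using assms
proof (induction T arbitrary: U M rule: finite_induct)
  case empty
  then show ?case
    by (intro exI[of _ "monom 1 M"]) (auto simp: sparse_interpolant_def coeff_monom)
next
  case (insert t T)
  then obtain u U' where U: "U = insert u U'" "u \<notin> U'"
    by (metis card_insert_disjoint card_Suc_eq)
  then have U': "finite U'" "U' \<subseteq> {0<..}" "card U' = card T" "u > 0"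
    using insert.prems insert.hyps by auto
  obtain q1 where q1: "sparse_interpolant T U' M q1" using insert U' by blast
  obtain q2 where q2: "sparse_interpolant T U' t q2" using insert U' by blast
  have "q2 \<noteq> 0" using q2 by (auto simp: sparse_interpolant_def)
  have nz: "poly q2 u \<noteq> 0"
  proof
    assume "poly q2 u = 0"
    then have "q2 = 0"
      using q2 insert U U' by (intro sparse_poly_eq_0[of "insert t T" U])
        (auto simp: sparse_interpolant_def)
    with \<open>q2 \<noteq> 0\<close> show False by simp
  qed
  have "coeff q2 M = 0" using q2 insert.prems insert.hyps by (auto simp: sparse_interpolant_def)
  then have "sparse_interpolant (insert t T) U M (q1 - smult (poly q1 u / poly q2 u) q2)"
    using q1 q2 nz U unfolding sparse_interpolant_def by simp
  then show ?case by blast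
qed

lemma sparse_interpolant_signs:
  assumes "finite T" "finite U" "U \<subseteq> {0<..}" "card U = card T" "M \<notin> T"
    and q: "sparse_interpolant T U M q"
  shows "\<exists>\<sigma>. \<forall>t\<in>insert M T. 0 < \<sigma> * (-1) ^ card {s \<in> insert M T. s < t} * coeff q t"
proof -
  interpret sparse_poly q "insert M T" U
    using assms by unfold_locales (auto simp: sparse_interpolant_def)
  have "q \<noteq> 0" using q by (auto simp: sparse_interpolant_def)
  then show ?thesis using signs assms by simp
qed

lemma sparse_interpolant_decomp:
  assumes "finite T" "finite U" "U \<subseteq> {0<..}" "card U = card T" "M \<notin> insert t T" "t \<notin> T"
    and q: "sparse_interpolant (insert t T) (insert u U) M q"
    and q1: "sparse_interpolant T U M q1" and q2: "sparse_interpolant T U t q2"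
  shows "q = q1 + smult (coeff q t) q2"
proof -
  have "q - q1 - smult (coeff q t) q2 = 0"
  proof (rule sparse_poly_eq_0[of T U])
    show "coeff (q - q1 - smult (coeff q t) q2) i = 0" if "i \<notin> T" for i
      using assms that by (cases "i = M"; cases "i = t") (auto simp: sparse_interpolant_def)
  qed (use assms in \<open>auto simp: sparse_interpolant_def\<close>)
  then show ?thesis by (simp add: algebra_simps)
qed

lemma coeff_roots_prod:
  fixes U :: "real set"
  assumes "finite U" "U \<subseteq> {0<..1}"
  shows "\<bar>coeff (\<Prod>u\<in>U. [:- u, 1:]) j\<bar> \<le> 2 ^ card U"
    and "coeff (\<Prod>u\<in>U. [:- u, 1:]) (card U) = 1"
    and "j > card U \<Longrightarrow> coeff (\<Prod>u\<in>U. [:- u, 1:]) j = 0"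
proof -
  let ?P = "\<lambda>U. \<Prod>u\<in>U. [:- u, 1:]"
  have "(\<forall>j. \<bar>coeff (?P U) j\<bar> \<le> 2 ^ card U) \<and> coeff (?P U) (card U) = 1 \<and>
      (\<forall>j>card U. coeff (?P U) j = 0)"
    using assms
  proof (induction U rule: finite_induct)
    case (insert u U)
    have u: "0 < u" "u \<le> 1" using insert.prems by auto
    have P: "?P (insert u U) = [:- u, 1:] * ?P U" using insert.hyps by simp
    have IH: "\<And>i. \<bar>coeff (?P U) i\<bar> \<le> 2 ^ card U" "coeff (?P U) (card U) = 1"
      "\<And>i. i > card U \<Longrightarrow> coeff (?P U) i = 0"
      using insert.IH insert.prems by auto
    have a: "\<bar>u * coeff (?P U) i\<bar> \<le> 2 ^ card U" for i
      using IH(1)[of i] u mult_mono[of u 1 "\<bar>coeff (?P U) i\<bar>" "2 ^ card U"]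
      by (simp add: abs_mult)
    have "\<bar>coeff ([:- u, 1:] * ?P U) j\<bar> \<le> 2 * 2 ^ card U" for j
    proof (cases j)
      case 0
      show ?thesis using a[of 0] unfolding 0 coeff_linear_mult_0 by simp
    next
      case (Suc k)
      show ?thesis using a[of "Suc k"] IH(1)[of k] unfolding Suc coeff_linear_mult_Suc by linarith
    qed
    moreover have "coeff ([:- u, 1:] * ?P U) (Suc (card U)) = 1"
      using IH(2) IH(3)[of "Suc (card U)"] by (simp add: coeff_linear_mult_Suc)
    moreover have "coeff ([:- u, 1:] * ?P U) j = 0" if "j > Suc (card U)" for j
      using that IH(3)[of "j - 1"] IH(3)[of j] by (cases j) (auto simp: coeff_linear_mult_Suc)
    ultimately show ?case unfolding P using insert.hyps by simp
  qed simp
  then show "\<bar>coeff (?P U) j\<bar> \<le> 2 ^ card U" "coeff (?P U) (card U) = 1"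
    "j > card U \<Longrightarrow> coeff (?P U) j = 0" by auto
qed

text \<open>
  Let $q = s \prod_{u \in U} (x - u)$. The factor has bounded coefficients since $U \subseteq (0, 1]$.
  Between $t$ and $M$ all coefficients of $q$ vanish, which determines the coefficients of $s$ recursively
  from the leading one and bounds them. At $t$ the coefficient of $q$ is a bounded quantity, plus a
  coefficient of $s$ if $t \ge |T|$, and the latter is nonnegative. Since the coefficient of $q$ at
  $t$ is negative, it is bounded.
\<close>

lemma sparse_interpolant_top_bound:
  assumes fin: "finite T" "finite U" and U: "U \<subseteq> {0<..1}" and card: "card U = card T"
    and TM: "\<And>s. s \<in> T \<Longrightarrow> s < M" and t: "t \<in> T" "\<And>s. s \<in> T \<Longrightarrow> s \<le> t"
    and q: "sparse_interpolant T U M q"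
  shows "\<bar>coeff q t\<bar> \<le> (real M + 1) * 2 ^ card T * ((real M + 1) * 2 ^ card T) ^ M"
proof -
  let ?P = "\<Prod>u\<in>U. [:- u, 1:]"
  define n where "n = card T"
  define K :: real where "K = (real M + 1) * 2 ^ n"
  have K1: "K \<ge> 1" unfolding K_def by (rule order_trans[OF _ mult_mono[of 1 _ 1]]) auto
  have Upos: "U \<subseteq> {0<..}" using U by auto
  have MT: "M \<notin> T" using TM by blast
  have qM: "coeff q M = 1" and supp: "\<And>i. coeff q i \<noteq> 0 \<Longrightarrow> i \<in> insert M T"
    and root: "\<And>u. u \<in> U \<Longrightarrow> poly q u = 0" using q by (auto simp: sparse_interpolant_def)
  interpret sparse_poly q "insert M T" U
    using fin Upos supp root by unfold_locales auto
  obtain s where s: "q = ?P * s" using roots_factor[OF fin(2) root] by blast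
  note P = coeff_roots_prod[OF fin(2) U, unfolded card, folded n_def]
  have degq: "degree q = M"
  proof (rule antisym)
    show "degree q \<le> M" by (rule degree_le) (use supp TM in force)
    show "M \<le> degree q" by (rule le_degree) (simp add: qM)
  qed
  have degP: "degree ?P = n"
    by (rule antisym) (auto intro!: degree_le le_degree simp: P)
  have nz: "?P \<noteq> 0" "s \<noteq> 0" using s qM by auto
  have degs: "degree s + n = M" using degree_mult_eq[OF nz] s degq degP by simp
  have lcs: "coeff s (degree s) = 1"
    using lead_coeff_mult[of ?P s] s degq degP qM P(2) by simp
  have s0: "coeff s i \<ge> 0" for i
    using quotient_signs[OF s, of i "degree s"] lcs fin MT card by simp
  \<comment> \<open>The exponents \<open>t\<close> and \<open>M\<close> are neighbours, so their coefficients have opposite signs.\<close>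
  have neg: "coeff q t < 0"
  proof -
    obtain \<sigma> where \<sigma>: "\<And>x. x \<in> insert M T \<Longrightarrow>
        0 < \<sigma> * (-1) ^ card {s \<in> insert M T. s < x} * coeff q x"
      using sparse_interpolant_signs[OF fin _ card MT q] U by fastforce
    have "{s \<in> insert M T. s < M} = insert t {s \<in> insert M T. s < t}"
      using t TM by (force simp: order.order_iff_strict)
    then have "card {s \<in> insert M T. s < M} = Suc (card {s \<in> insert M T. s < t})"
      using fin by simp
    then show ?thesis using \<sigma>[of M] \<sigma>[of t] t qM
      by (auto simp: zero_less_mult_iff mult_less_0_iff)
  qed
  have q_eq: "coeff q i = (\<Sum>j\<le>i. coeff ?P j * coeff s (i - j))" for i
    unfolding s coeff_mult ..
  have term_bound: "- (coeff ?P j * coeff s i) \<le> 2 ^ n * B" if "coeff s i \<le> B" for i j B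
  proof -
    have "- (coeff ?P j * coeff s i) \<le> \<bar>coeff ?P j\<bar> * coeff s i"
      using s0[of i] abs_ge_minus_self[of "coeff ?P j * coeff s i"] by (simp add: abs_mult)
    also have "\<dots> \<le> 2 ^ n * B" using P(1)[of j] s0[of i] that by (intro mult_mono) auto
    finally show ?thesis .
  qed
  have s_bound: "coeff s i \<le> K ^ l" if "i + n + l = M" "i + n > t" for i l
    using that
  proof (induction l arbitrary: i rule: less_induct)
    case (less l)
    show ?case
    proof (cases "l = 0")
      case True
      then have "i = degree s" using less.prems degs by simp
      then show ?thesis using lcs True by simp
    next
      case False
      \<comment> \<open>The coefficient of \<open>q\<close> at \<open>i + n\<close> is zero; solve for the term with \<open>coeff s i\<close>.\<close>
      have "i + n \<notin> insert M T" using less.prems False t(2)[of "i + n"] by auto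
      then have "0 = (\<Sum>j\<le>i + n. coeff ?P j * coeff s (i + n - j))"
        using supp q_eq[of "i + n"] by metis
      also have "\<dots> = coeff s i + (\<Sum>j\<in>{..i + n} - {n}. coeff ?P j * coeff s (i + n - j))"
        by (subst sum.remove[of _ n]) (auto simp: P(2))
      finally have "coeff s i = (\<Sum>j\<in>{..i + n} - {n}. - (coeff ?P j * coeff s (i + n - j)))"
        by (simp add: sum_negf)
      also have "\<dots> \<le> (\<Sum>j\<in>{..i + n} - {n}. 2 ^ n * K ^ (l - 1))"
      proof (rule sum_mono)
        fix j assume j: "j \<in> {..i + n} - {n}"
        have K0: "0 \<le> K ^ (l - 1)" using K1 by simp
        show "- (coeff ?P j * coeff s (i + n - j)) \<le> 2 ^ n * K ^ (l - 1)"
        proof (cases "j < n")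
          case True
          show ?thesis
          proof (cases "n - j \<le> l")
            case l: True
            have "coeff s (i + n - j) \<le> K ^ (l - (n - j))"
              using less.IH[of "l - (n - j)" "i + n - j"] less.prems l True j by auto
            also have "\<dots> \<le> K ^ (l - 1)" using K1 True by (intro power_increasing) auto
            finally show ?thesis by (rule term_bound)
          next
            case l: False
            then have "coeff s (i + n - j) = 0"
              using degs less.prems by (intro coeff_eq_0) auto
            then show ?thesis using K0 by simp
          qed
        next
          case False
          then show ?thesis using P(3)[of j] j K0 by simp
        qed
      qed
      also have "\<dots> = real (i + n) * (2 ^ n * K ^ (l - 1))" by simp
      also have "\<dots> \<le> (real M + 1) * (2 ^ n * K ^ (l - 1))"
        using less.prems K1 by (intro mult_right_mono) auto
      also have "\<dots> = K ^ l" using False unfolding K_def by (cases l) auto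
      finally show ?thesis .
    qed
  qed
  have "- coeff q t = (\<Sum>j\<le>t. - (coeff ?P j * coeff s (t - j)))"
    unfolding q_eq by (simp add: sum_negf)
  also have "\<dots> \<le> (\<Sum>j\<le>t. 2 ^ n * K ^ M)"
  proof (rule sum_mono)
    fix j assume j: "j \<in> {..t}"
    have K0: "0 \<le> K ^ M" using K1 by simp
    consider "j < n" | "j = n" | "j > n" by linarith
    then show "- (coeff ?P j * coeff s (t - j)) \<le> 2 ^ n * K ^ M"
    proof cases
      case 1
      show ?thesis
      proof (cases "t - j + n \<le> M")
        case True
        then have "coeff s (t - j) \<le> K ^ (M - (t - j + n))" using j 1 by (intro s_bound) auto
        also have "\<dots> \<le> K ^ M" using K1 by (intro power_increasing) auto
        finally show ?thesis by (rule term_bound)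
      next
        case False
        then have "coeff s (t - j) = 0" using degs by (intro coeff_eq_0) auto
        then show ?thesis using K0 by simp
      qed
    next
      case 2
      have "- coeff s (t - n) \<le> 0" using s0 by simp
      also have "0 \<le> 2 ^ n * K ^ M" using K0 by simp
      finally show ?thesis using 2 P(2) by simp
    next
      case 3
      then show ?thesis using P(3)[of j] K0 by simp
    qed
  qed
  also have "\<dots> = (real t + 1) * (2 ^ n * K ^ M)" by simp
  also have "\<dots> \<le> (real M + 1) * (2 ^ n * K ^ M)"
    using TM[OF t(1)] K1 by (intro mult_right_mono) auto
  finally show ?thesis using neg unfolding K_def n_def by (simp add: mult.assoc)
qed

text \<open>
  Induction on the number of exponents: by \<open>sparse_interpolant_decomp\<close> the interpolant is a
  combination of two interpolants with one exponent and one node fewer, and the coefficient in this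
  combination is the top one, which is already bounded. The target exponent changes from \<open>M\<close> to
  \<open>t\<close> in one of them, so \<open>M\<close> has to vary in the induction.
\<close>

lemma sparse_interpolant_bound_below:
  assumes "finite T" "\<And>t. t \<in> T \<Longrightarrow> t < M"
  shows "\<exists>C\<ge>0. \<forall>U q. finite U \<longrightarrow> U \<subseteq> {0<..1} \<longrightarrow> card U = card T \<longrightarrow>
           sparse_interpolant T U M q \<longrightarrow> (\<forall>i. \<bar>coeff q i\<bar> \<le> C)"
  using assms
proof (induction T arbitrary: M rule: finite_linorder_max_induct)
  case empty
  have "\<bar>coeff q i\<bar> \<le> 1" if "sparse_interpolant {} U M q" for U q i
    using that by (cases "i = M") (simp_all add: sparse_interpolant_def)
  then show ?case by (intro exI[of _ 1]) auto
next
  case (insert t T)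
  let ?A = "insert t T"
  have t: "t \<notin> T" using insert.hyps by auto
  obtain C1 where C1: "C1 \<ge> 0" "\<And>U q i. finite U \<Longrightarrow> U \<subseteq> {0<..1} \<Longrightarrow> card U = card T \<Longrightarrow>
      sparse_interpolant T U M q \<Longrightarrow> \<bar>coeff q i\<bar> \<le> C1"
    using insert.IH[of M] insert.prems by (metis insert_iff)
  obtain C2 where C2: "C2 \<ge> 0" "\<And>U q i. finite U \<Longrightarrow> U \<subseteq> {0<..1} \<Longrightarrow> card U = card T \<Longrightarrow>
      sparse_interpolant T U t q \<Longrightarrow> \<bar>coeff q i\<bar> \<le> C2"
    using insert.IH[of t] insert.hyps by metis
  define C0 :: real where "C0 = (real M + 1) * 2 ^ card ?A * ((real M + 1) * 2 ^ card ?A) ^ M"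
  have C0: "C0 \<ge> 0" unfolding C0_def by simp
  have "\<bar>coeff q i\<bar> \<le> C1 + C0 * C2"
    if U: "finite U" "U \<subseteq> {0<..1}" "card U = card ?A" and q: "sparse_interpolant ?A U M q" for U q i
  proof -
    obtain u U' where U': "U = insert u U'" "u \<notin> U'" "card U' = card T"
      using U insert.hyps t by (metis card_insert_disjoint card_Suc_eq)
    have U'f: "finite U'" "U' \<subseteq> {0<..1}" "U' \<subseteq> {0<..}" using U U' by auto
    have MA: "M \<notin> ?A" using insert.prems by blast
    obtain q1 where q1: "sparse_interpolant T U' M q1"
      using sparse_interpolant_exists[of T U' M] U'f U' insert.hyps MA by auto
    obtain q2 where q2: "sparse_interpolant T U' t q2"
      using sparse_interpolant_exists[of T U' t] U'f U' insert.hyps t by auto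
    have q_eq: "q = q1 + smult (coeff q t) q2"
      using sparse_interpolant_decomp[OF insert.hyps(1) U'f(1,3) U'(3) MA t _ q1 q2] q U' by simp
    have top: "\<bar>coeff q t\<bar> \<le> C0" unfolding C0_def
      using insert.hyps insert.prems U q
      by (intro sparse_interpolant_top_bound[of _ U]) (auto intro: less_imp_le)
    have "coeff q i = coeff q1 i + coeff q t * coeff q2 i" by (subst q_eq) simp
    then have "\<bar>coeff q i\<bar> \<le> \<bar>coeff q1 i\<bar> + \<bar>coeff q t\<bar> * \<bar>coeff q2 i\<bar>"
      by (metis abs_mult abs_triangle_ineq)
    also have "\<dots> \<le> C1 + C0 * C2"
      using C1(2)[OF U'f(1,2) U'(3) q1] C2(2)[OF U'f(1,2) U'(3) q2] top C0
      by (intro add_mono mult_mono) auto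
    finally show ?thesis .
  qed
  moreover have "C1 + C0 * C2 \<ge> 0" using C1(1) C2(1) C0 by simp
  ultimately show ?case by (intro exI[of _ "C1 + C0 * C2"]) simp
qed

lemma card_less_insert:
  assumes "finite T" "t \<notin> T"
  shows "card {s \<in> insert t T. s < (x::nat)} = card {s \<in> T. s < x} + (if t < x then 1 else 0)"
proof -
  have "{s \<in> insert t T. s < x} = (if t < x then insert t {s \<in> T. s < x} else {s \<in> T. s < x})"
    by auto
  then show ?thesis using assms by simp
qed

text \<open>
  The remainders before and after adding the exponent \<open>t\<close> differ by a polynomial with exponents
  in \<open>insert t T\<close> that vanishes on \<open>U\<close>. Descartes' rule gives the signs of all coefficients of the two
  remainders and of their difference. If \<open>e\<close> and \<open>t\<close> are on
  opposite sides of \<open>M\<close>, these signs say that the coefficient at \<open>e\<close> moves towards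
  zero without crossing it.
\<close>

lemma sparse_interpolant_add_node:
  assumes fin: "finite T" "finite U" and U: "insert u U \<subseteq> {0<..}" "u \<notin> U" and card: "card U = card T"
    and M: "M \<notin> insert t T" and t: "t \<notin> T"
    and q: "sparse_interpolant (insert t T) (insert u U) M q"
    and q1: "sparse_interpolant T U M q1"
    and e: "e \<in> T" "e < M \<and> M < t \<or> t < M \<and> M < e"
  shows "\<bar>coeff q e\<bar> \<le> \<bar>coeff q1 e\<bar>"
proof -
  define n where "n x = card {s \<in> T. s < x}" for x
  have MT: "M \<notin> T" "M \<noteq> t" using M by auto
  have c1: "card {s \<in> insert M T. s < x} = n x + (if M < x then 1 else 0)" for x
    unfolding n_def using card_less_insert fin MT by simp
  have c2: "card {s \<in> insert t T. s < x} = n x + (if t < x then 1 else 0)" for x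
    unfolding n_def using card_less_insert fin t by simp
  have c: "card {s \<in> insert M (insert t T). s < x}
      = n x + (if t < x then 1 else 0) + (if M < x then 1 else 0)" for x
    using card_less_insert[of "insert t T" M x] c2 fin M by simp
  obtain \<sigma>1 where s1: "\<And>x. x \<in> insert M T \<Longrightarrow>
      0 < \<sigma>1 * (-1) ^ card {s \<in> insert M T. s < x} * coeff q1 x"
    using sparse_interpolant_signs[OF fin _ card MT(1) q1] U by blast
  obtain \<sigma> where s: "\<And>x. x \<in> insert M (insert t T) \<Longrightarrow>
      0 < \<sigma> * (-1) ^ card {s \<in> insert M (insert t T). s < x} * coeff q x"
    using sparse_interpolant_signs[OF _ _ U(1) _ M q] U fin card t by auto
  have qM: "coeff q M = 1" "coeff q1 M = 1" using q q1 by (auto simp: sparse_interpolant_def)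
  have q1t: "coeff q1 t = 0" using q1 t MT by (auto simp: sparse_interpolant_def)
  interpret r: sparse_poly "q - q1" "insert t T" U
  proof unfold_locales
    show "i \<in> insert t T" if "coeff (q - q1) i \<noteq> 0" for i
      using that q q1 qM by (cases "i = M") (auto simp: sparse_interpolant_def)
  qed (use fin U q q1 in \<open>auto simp: sparse_interpolant_def\<close>)
  have "coeff q t \<noteq> 0" using s[of t] by auto
  then have "q - q1 \<noteq> 0" using q1t by auto
  then obtain \<rho> where sr: "\<And>x. x \<in> insert t T \<Longrightarrow>
      0 < \<rho> * (-1) ^ card {s \<in> insert t T. s < x} * coeff (q - q1) x"
    using r.signs card fin t by auto
  have same: "0 < x * y" if "0 < \<tau> * x" "0 < \<tau> * y" for \<tau> x y :: real
    using that by (auto simp: zero_less_mult_iff)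
  define A B D where "A = (-1 :: real) ^ n e" and "B = (-1 :: real) ^ n M" and "D = (-1 :: real) ^ n t"
  note defs = A_def B_def D_def
  have k1: "(-1) ^ card {s \<in> insert M T. s < M} = B"
    "(-1) ^ card {s \<in> insert M T. s < e} = (if M < e then - A else A)"
    unfolding c1 defs by simp_all
  have k: "(-1) ^ card {s \<in> insert M (insert t T). s < M} = (if t < M then - B else B)"
    "(-1) ^ card {s \<in> insert M (insert t T). s < e} = A"
    "(-1) ^ card {s \<in> insert M (insert t T). s < t} = (if M < t then - D else D)"
    using e(2) unfolding c defs by auto
  have k2: "(-1) ^ card {s \<in> insert t T. s < t} = D"
    "(-1) ^ card {s \<in> insert t T. s < e} = (if t < e then - A else A)"
    unfolding c2 defs by simp_all
  have p1: "0 < B * ((if M < e then - A else A) * coeff q1 e)"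
    by (rule same[of \<sigma>1]) (use s1[of M, unfolded k1 qM] s1[of e, unfolded k1] e(1) in \<open>simp_all add: mult.assoc\<close>)
  have p2: "0 < (if t < M then - B else B) * (A * coeff q e)"
    by (rule same[of \<sigma>]) (use s[of M, unfolded k qM] s[of e, unfolded k] e(1) in \<open>simp_all add: mult.assoc\<close>)
  have "0 < (if t < M then - B else B) * ((if M < t then - D else D) * coeff q t)"
    by (rule same[of \<sigma>]) (use s[of M, unfolded k qM] s[of t, unfolded k] in \<open>simp_all add: mult.assoc\<close>)
  then have p3: "0 < coeff q t * ((if t < M then - B else B) * (if M < t then - D else D))"
    by (simp only: mult.commute mult.left_commute)
  have "0 < (D * coeff q t) * ((if t < e then - A else A) * (coeff q e - coeff q1 e))"
    by (rule same[of \<rho>]) (use sr[of t, unfolded k2] sr[of e, unfolded k2] q1t e(1) in \<open>simp_all add: mult.assoc\<close>)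
  then have p4: "0 < coeff q t * (D * ((if t < e then - A else A) * (coeff q e - coeff q1 e)))"
    by (simp only: mult.commute mult.left_commute)
  note p5 = same[OF p3 p4]
  have "A = 1 \<or> A = -1" "B = 1 \<or> B = -1" "D = 1 \<or> D = -1"
    unfolding defs by (simp_all add: power_minus1_even minus_one_power_iff)
  then show ?thesis using p1 p2 p5 e(2)
    by (elim disjE) simp_all
qed

lemma sparse_interpolant_drop_far_nodes:
  assumes "finite F" "finite W" "card W = card F" "finite E" "finite V" "card V = card E"
    "V \<union> W \<subseteq> {0<..}" "V \<inter> W = {}" "E \<inter> F = {}" "M \<notin> E \<union> F"
    "\<And>e f. e \<in> E \<Longrightarrow> f \<in> F \<Longrightarrow> e < M \<and> M < f \<or> f < M \<and> M < e"
    "sparse_interpolant (E \<union> F) (V \<union> W) M q"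
  shows "\<exists>q0. sparse_interpolant E V M q0 \<and> (\<forall>e\<in>E. \<bar>coeff q e\<bar> \<le> \<bar>coeff q0 e\<bar>)"
  using assms
proof (induction F arbitrary: W q rule: finite_induct)
  case empty
  then show ?case by auto
next
  case (insert f F)
  then obtain w W' where W: "W = insert w W'" "w \<notin> W'" "card W' = card F"
    by (metis card_insert_disjoint card_Suc_eq)
  have fin: "finite W'" using insert.prems W by simp
  have cards: "card (V \<union> W') = card (E \<union> F)"
    using insert.prems insert.hyps W fin by (subst (1 2) card_Un_disjoint) auto
  obtain q1 where q1: "sparse_interpolant (E \<union> F) (V \<union> W') M q1"
    using sparse_interpolant_exists[of "E \<union> F" "V \<union> W'" M] cards insert.prems insert.hyps W fin
    by auto
  obtain q0 where q0: "sparse_interpolant E V M q0" "\<And>e. e \<in> E \<Longrightarrow> \<bar>coeff q1 e\<bar> \<le> \<bar>coeff q0 e\<bar>"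
    using insert.IH[of W' q1] insert.prems q1 W fin by auto
  have "\<bar>coeff q e\<bar> \<le> \<bar>coeff q1 e\<bar>" if e: "e \<in> E" for e
  proof (rule sparse_interpolant_add_node[of "E \<union> F" "V \<union> W'" w M f])
    show "sparse_interpolant (insert f (E \<union> F)) (insert w (V \<union> W')) M q"
      using insert.prems W by simp
  qed (use insert.prems insert.hyps W fin cards q1 e in auto)
  then show ?case using q0 order_trans by blast
qed

text \<open>
  This transfers bounds for exponents below the target and nodes at most 1 to exponents above the target
  and nodes greater than 1. The reflected coefficients sit at $D - t$ since the degree of \<open>q\<close> is exactly
  \<open>D\<close>: by Descartes' rule none of the coefficients vanishes.
\<close>

lemma sparse_interpolant_reflect:
  assumes fin: "finite T" "finite U" and U: "U \<subseteq> {0<..}" and card: "card U = card T"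
    and M: "\<And>t. t \<in> T \<Longrightarrow> M < t" and q: "sparse_interpolant T U M q"
  defines "D \<equiv> Max (insert M T)"
  shows "sparse_interpolant ((\<lambda>t. D - t) ` T) (inverse ` U) (D - M) (reflect_poly q)"
    and "\<And>t. t \<in> T \<Longrightarrow> coeff (reflect_poly q) (D - t) = coeff q t"
proof -
  have MT: "M \<notin> T" using M by blast
  have D: "D \<in> insert M T" unfolding D_def using fin by (intro Max_in) auto
  have le: "x \<le> D" if "x \<in> insert M T" for x unfolding D_def using fin that by simp
  have deg: "degree q = D"
  proof (rule antisym)
    have "coeff q i = 0" if "i > D" for i
      using q le[of i] that by (meson not_less sparse_interpolant_def)
    then show "degree q \<le> D" by (intro degree_le) blast
    obtain \<sigma> where "0 < \<sigma> * (-1) ^ card {s \<in> insert M T. s < D} * coeff q D"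
      using sparse_interpolant_signs[OF fin U card MT q] D by blast
    then have "coeff q D \<noteq> 0" by auto
    then show "D \<le> degree q" by (rule le_degree)
  qed
  have co: "coeff (reflect_poly q) (D - t) = coeff q t" if "t \<in> insert M T" for t
    using le[OF that] by (simp add: coeff_reflect_poly deg)
  then show "coeff (reflect_poly q) (D - t) = coeff q t" if "t \<in> T" for t using that by blast
  show "sparse_interpolant ((\<lambda>t. D - t) ` T) (inverse ` U) (D - M) (reflect_poly q)"
    unfolding sparse_interpolant_def
  proof (intro conjI allI impI ballI)
    show "coeff (reflect_poly q) (D - M) = 1" using co q by (simp add: sparse_interpolant_def)
  next
    fix i assume i: "i \<notin> insert (D - M) ((\<lambda>t. D - t) ` T)"
    show "coeff (reflect_poly q) i = 0"
    proof (cases "i \<le> D")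
      case True
      then have "i = D - (D - i)" by simp
      then have "D - i \<notin> insert M T" using i by blast
      then show ?thesis using q True by (simp add: coeff_reflect_poly deg sparse_interpolant_def)
    qed (simp add: coeff_reflect_poly deg)
  next
    fix v assume "v \<in> inverse ` U"
    then obtain u where u: "u \<in> U" "v = inverse u" "u > 0" using U by auto
    have "poly (reflect_poly q) v = v ^ degree q * poly q (inverse v)"
      by (rule poly_reflect_poly_nz) (use u in simp)
    then show "poly (reflect_poly q) v = 0"
      using q u by (simp add: sparse_interpolant_def)
  qed
qed

lemma sparse_interpolant_bound_above:
  assumes fin: "finite T" and M: "\<And>t. t \<in> T \<Longrightarrow> M < t"
  shows "\<exists>C\<ge>0. \<forall>U q. finite U \<longrightarrow> U \<subseteq> {1<..} \<longrightarrow> card U = card T \<longrightarrow>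
           sparse_interpolant T U M q \<longrightarrow> (\<forall>i\<in>T. \<bar>coeff q i\<bar> \<le> C)"
proof -
  define D where "D = Max (insert M T)"
  have le: "x \<le> D" if "x \<in> insert M T" for x unfolding D_def using fin that by simp
  let ?T = "(\<lambda>t. D - t) ` T"
  have card: "card ?T = card T"
    by (intro card_image inj_onI) (metis diff_diff_cancel le insertI2)
  have "s < D - M" if "s \<in> ?T" for s using that M le by (auto intro!: diff_less_mono2 dest: M)
      (meson M insertI2 le order.strict_trans2)
  then obtain C where C: "C \<ge> 0" "\<And>U q i. finite U \<Longrightarrow> U \<subseteq> {0<..1} \<Longrightarrow> card U = card ?T \<Longrightarrow>
      sparse_interpolant ?T U (D - M) q \<Longrightarrow> \<bar>coeff q i\<bar> \<le> C"
    using sparse_interpolant_bound_below[of ?T "D - M"] fin by auto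
  have "\<bar>coeff q t\<bar> \<le> C" if U: "finite U" "U \<subseteq> {1<..}" "card U = card T"
    and q: "sparse_interpolant T U M q" and t: "t \<in> T" for U q t
  proof -
    have U0: "U \<subseteq> {0<..}" using U by force
    have r: "sparse_interpolant ?T (inverse ` U) (D - M) (reflect_poly q)"
      "coeff (reflect_poly q) (D - t) = coeff q t"
      using sparse_interpolant_reflect[OF fin U(1) U0 U(3) _ q] M t unfolding D_def by blast+
    have "inverse ` U \<subseteq> {0<..1}" using U by (force simp: inverse_le_1_iff)
    moreover have "card (inverse ` U) = card U" by (intro card_image inj_onI) simp
    ultimately have "\<bar>coeff (reflect_poly q) (D - t)\<bar> \<le> C"
      using C(2)[OF _ _ _ r(1)] U card by simp
    then show ?thesis using r(2) by simp
  qed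
  then show ?thesis using C(1) by auto
qed

text \<open>
  The exponents below \<open>M\<close> are accompanied by as many nodes at most 1, and those above \<open>M\<close> by
  as many nodes above 1. Dropping all exponents on one side, together with their nodes, can only
  increase the absolute values of the coefficients on the other side, where the one-sided bounds apply.
\<close>

lemma sparse_interpolant_bound:
  assumes fin: "finite E" "finite F" and M: "\<And>e. e \<in> E \<Longrightarrow> e < M" "\<And>f. f \<in> F \<Longrightarrow> M < f"
  shows "\<exists>C\<ge>0. \<forall>V W q. finite V \<longrightarrow> finite W \<longrightarrow> V \<subseteq> {0<..1} \<longrightarrow> W \<subseteq> {1<..} \<longrightarrow>
           card V = card E \<longrightarrow> card W = card F \<longrightarrow>
           sparse_interpolant (E \<union> F) (V \<union> W) M q \<longrightarrow> (\<forall>i\<in>E \<union> F. \<bar>coeff q i\<bar> \<le> C)"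
proof -
  obtain C1 where C1: "C1 \<ge> 0" "\<And>U q i. finite U \<Longrightarrow> U \<subseteq> {0<..1} \<Longrightarrow> card U = card E \<Longrightarrow>
      sparse_interpolant E U M q \<Longrightarrow> \<bar>coeff q i\<bar> \<le> C1"
    using sparse_interpolant_bound_below[of E M] fin M by metis
  obtain C2 where C2: "C2 \<ge> 0" "\<And>U q i. finite U \<Longrightarrow> U \<subseteq> {1<..} \<Longrightarrow> card U = card F \<Longrightarrow>
      sparse_interpolant F U M q \<Longrightarrow> i \<in> F \<Longrightarrow> \<bar>coeff q i\<bar> \<le> C2"
    using sparse_interpolant_bound_above[of F M] fin M by metis
  have "\<bar>coeff q i\<bar> \<le> max C1 C2"
    if VW: "finite V" "finite W" "V \<subseteq> {0<..1}" "W \<subseteq> {1<..}" "card V = card E" "card W = card F"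
      and q: "sparse_interpolant (E \<union> F) (V \<union> W) M q" and i: "i \<in> E \<union> F" for V W q i
  proof -
    have disj: "V \<inter> W = {}" "E \<inter> F = {}" "M \<notin> E \<union> F" using VW M by force+
    have pos: "V \<union> W \<subseteq> {0<..}" using VW by force
    show ?thesis
    proof (cases "i \<in> E")
      case True
      obtain q0 where "sparse_interpolant E V M q0" "\<bar>coeff q i\<bar> \<le> \<bar>coeff q0 i\<bar>"
        using sparse_interpolant_drop_far_nodes[OF fin(2) VW(2,6) fin(1) VW(1,5) pos disj _ q]
          M True by blast
      then show ?thesis using C1(2)[OF VW(1,3,5), of q0 i] by linarith
    next
      case False
      then have iF: "i \<in> F" using i by simp
      have "\<exists>q0. sparse_interpolant F W M q0 \<and> (\<forall>e\<in>F. \<bar>coeff q e\<bar> \<le> \<bar>coeff q0 e\<bar>)"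
        by (rule sparse_interpolant_drop_far_nodes[of E V F W M q])
          (use VW fin pos disj M q in \<open>auto simp: Un_commute\<close>)
      then obtain q0 where "sparse_interpolant F W M q0" "\<bar>coeff q i\<bar> \<le> \<bar>coeff q0 i\<bar>"
        using iF by blast
      then show ?thesis using C2(2)[OF VW(2,4,6), of q0 i] iF by linarith
    qed
  qed
  then show ?thesis using C1(1) by (intro exI[of _ "max C1 C2"]) auto
qed

text \<open>
  The numbers of nodes below and above 1 vary with \<open>U\<close>. Having \<open>N\<close> exponents on
  either side of \<open>M\<close>, one can always select matching subsets of exponents, and there are only
  finitely many such choices.
\<close>

theorem bounded_interpolation:
  assumes fin: "finite E" "finite F" and M: "\<And>e. e \<in> E \<Longrightarrow> e < M" "\<And>f. f \<in> F \<Longrightarrow> M < f"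
    and card: "N \<le> card E" "N \<le> card F"
  shows "\<exists>C\<ge>0. \<forall>U. finite U \<longrightarrow> U \<subseteq> {0<..} \<longrightarrow> card U \<le> N \<longrightarrow>
           (\<exists>a. (\<forall>e\<in>E \<union> F. \<bar>a e\<bar> \<le> C) \<and> (\<forall>u\<in>U. u ^ M = (\<Sum>e\<in>E \<union> F. a e * u ^ e :: real)))"
proof -
  define bound where "bound A B C \<longleftrightarrow> C \<ge> 0 \<and> (\<forall>V W q. finite V \<longrightarrow> finite W \<longrightarrow> V \<subseteq> {0<..1} \<longrightarrow>
      W \<subseteq> {1<..} \<longrightarrow> card V = card A \<longrightarrow> card W = card B \<longrightarrow>
      sparse_interpolant (A \<union> B) (V \<union> W) M q \<longrightarrow> (\<forall>i\<in>A \<union> B. \<bar>coeff q i\<bar> \<le> C))" for A B C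
  have "\<exists>C. bound A B C" if "A \<subseteq> E" "B \<subseteq> F" for A B
    unfolding bound_def
    by (rule sparse_interpolant_bound) (use that fin M in \<open>auto intro: finite_subset\<close>)
  then obtain C where C: "\<And>A B. A \<subseteq> E \<Longrightarrow> B \<subseteq> F \<Longrightarrow> bound A B (C A B)"
    by metis
  have C0: "C A B \<ge> 0" if "A \<subseteq> E" "B \<subseteq> F" for A B
    using C[OF that] by (simp add: bound_def)
  define K where "K = (\<Sum>(A, B)\<in>Pow E \<times> Pow F. C A B)"
  have K: "C A B \<le> K" if "A \<subseteq> E" "B \<subseteq> F" for A B
    unfolding K_def
    using member_le_sum[of "(A, B)" "Pow E \<times> Pow F" "\<lambda>(A, B). C A B"] that fin C0 by auto
  have K0: "K \<ge> 0" using K[of "{}" "{}"] C0[of "{}" "{}"] by simp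
  have "\<exists>a. (\<forall>e\<in>E \<union> F. \<bar>a e\<bar> \<le> K) \<and> (\<forall>u\<in>U. u ^ M = (\<Sum>e\<in>E \<union> F. a e * u ^ e))"
    if U: "finite U" "U \<subseteq> {0<..}" "card U \<le> N" for U :: "real set"
  proof -
    define V W where "V = {u \<in> U. u \<le> 1}" and "W = {u \<in> U. u > 1}"
    have VW: "finite V" "finite W" "V \<subseteq> {0<..1}" "W \<subseteq> {1<..}" "U = V \<union> W"
      using U by (auto simp: V_def W_def)
    have "card V \<le> card U" "card W \<le> card U" using U by (auto simp: V_def W_def intro!: card_mono)
    then obtain A B where AB: "A \<subseteq> E" "card A = card V" "B \<subseteq> F" "card B = card W"
      using obtain_subset_with_card_n[of "card V" E] obtain_subset_with_card_n[of "card W" F] card U(3)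
      by (metis order_trans)
    have finAB: "finite A" "finite B" using AB fin finite_subset by auto
    have disj: "V \<inter> W = {}" "A \<inter> B = {}" "M \<notin> A \<union> B" using VW AB M by force+
    have "card U = card (A \<union> B)"
      unfolding VW(5) using disj finAB VW AB by (simp add: card_Un_disjoint)
    then obtain q where q: "sparse_interpolant (A \<union> B) U M q"
      using sparse_interpolant_exists[of "A \<union> B" U M] finAB U disj by auto
    have bd: "\<bar>coeff q i\<bar> \<le> K" if "i \<in> A \<union> B" for i
      using C[OF AB(1,3)] VW(1-4) q[unfolded VW(5)] AB K[OF AB(1,3)] that
      unfolding bound_def by (metis order_trans)
    have supp: "\<And>i. coeff q i \<noteq> 0 \<Longrightarrow> i \<in> insert M (A \<union> B)"
      using q unfolding sparse_interpolant_def by blast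
    have "\<bar>- coeff q e\<bar> \<le> K" if "e \<in> E \<union> F" for e
    proof (cases "e \<in> A \<union> B")
      case False
      have "e \<noteq> M" using M that by auto
      then have "coeff q e = 0" using supp[of e] False by blast
      then show ?thesis using K0 by simp
    qed (use bd in simp)
    moreover have "u ^ M = (\<Sum>e\<in>E \<union> F. - coeff q e * u ^ e)" if "u \<in> U" for u
    proof -
      have "0 = (\<Sum>e\<in>insert M (E \<union> F). coeff q e * u ^ e)"
        using poly_eq_sum_support[of "insert M (E \<union> F)" q u] supp AB fin q that
        by (auto simp: sparse_interpolant_def)
      also have "\<dots> = u ^ M + (\<Sum>e\<in>E \<union> F. coeff q e * u ^ e)"
        using q fin M by (subst sum.insert) (auto simp: sparse_interpolant_def)
      finally show ?thesis by (simp add: sum_negf)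
    qed
    ultimately show ?thesis by (intro exI[of _ "\<lambda>e. - coeff q e"]) auto
  qed
  then show ?thesis using K0 by blast
qed

section \<open>Positive semidefinite real matrices\<close>

text \<open>
  Matrices are functions of which only the values at indices below \<open>N\<close> matter. In this form
  leading minors need no conversion, which suits inductions on the size.
\<close>

definition quad_form :: "nat \<Rightarrow> (nat \<Rightarrow> nat \<Rightarrow> real) \<Rightarrow> (nat \<Rightarrow> real) \<Rightarrow> real" where
  "quad_form N A v = (\<Sum>i<N. \<Sum>j<N. v i * v j * A i j)"

definition psd :: "nat \<Rightarrow> (nat \<Rightarrow> nat \<Rightarrow> real) \<Rightarrow> bool" where
  "psd N A \<longleftrightarrow> (\<forall>i<N. \<forall>j<N. A i j = A j i) \<and> (\<forall>v. 0 \<le> quad_form N A v)"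

lemma quad_form_cong:
  "(\<And>i j. i < N \<Longrightarrow> j < N \<Longrightarrow> A i j = B i j) \<Longrightarrow> quad_form N A v = quad_form N B v"
  unfolding quad_form_def by (intro sum.cong) auto

lemma quad_form_add: "quad_form N (\<lambda>i j. A i j + B i j) v = quad_form N A v + quad_form N B v"
  by (simp add: quad_form_def distrib_left sum.distrib)

lemma quad_form_cmult: "quad_form N (\<lambda>i j. c * A i j) v = c * quad_form N A v"
  by (simp add: quad_form_def sum_distrib_left mult_ac)

lemma quad_form_sum:
  "quad_form N (\<lambda>i j. \<Sum>e\<in>S. A e i j) v = (\<Sum>e\<in>S. quad_form N (A e) v)"
proof -
  have "quad_form N (\<lambda>i j. \<Sum>e\<in>S. A e i j) v = (\<Sum>i<N. \<Sum>e\<in>S. \<Sum>j<N. v i * v j * A e i j)"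
    unfolding quad_form_def sum_distrib_left by (subst (2) sum.swap) simp
  also have "\<dots> = (\<Sum>e\<in>S. quad_form N (A e) v)"
    unfolding quad_form_def by (rule sum.swap)
  finally show ?thesis .
qed

lemma quad_form_rank_one: "quad_form N (\<lambda>i j. w i * w j) v = (\<Sum>i<N. v i * w i)\<^sup>2"
  by (simp add: quad_form_def power2_eq_square sum_product mult_ac)

lemma quad_form_Suc:
  "quad_form (Suc N) A v = quad_form N A v + v N * (\<Sum>i<N. v i * A i N)
     + v N * (\<Sum>j<N. v j * A N j) + v N * v N * A N N"
  by (simp add: quad_form_def sum.distrib sum_distrib_left mult_ac)

lemma quad_form_Suc_sym:
  assumes "psd (Suc N) A"
  shows "quad_form (Suc N) A v = quad_form N A v + 2 * v N * (\<Sum>i<N. v i * A i N) + (v N)\<^sup>2 * A N N"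
proof -
  have "(\<Sum>j<N. v j * A N j) = (\<Sum>j<N. v j * A j N)"
    using assms by (intro sum.cong) (auto simp: psd_def)
  then show ?thesis unfolding quad_form_Suc by (simp add: power2_eq_square)
qed

lemma psd_minor: "psd (Suc N) A \<Longrightarrow> psd N A"
  unfolding psd_def
proof (intro conjI allI impI)
  fix v assume A: "(\<forall>i<Suc N. \<forall>j<Suc N. A i j = A j i) \<and> (\<forall>v. 0 \<le> quad_form (Suc N) A v)"
  have "quad_form (Suc N) A (v(N := 0)) = quad_form N A v"
    by (simp add: quad_form_Suc) (simp add: quad_form_def)
  then show "0 \<le> quad_form N A v" using A by metis
qed auto

text \<open>
  Minimising the quadratic form over the last coordinate of the vector gives the quadratic form of the
  Schur complement.
\<close>

lemma psd_schur_complement: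
  assumes A: "psd (Suc N) A" and pos: "A N N > 0"
  shows "psd N (\<lambda>i j. A i j - A i N * A j N / A N N)"
  unfolding psd_def
proof (intro conjI allI impI)
  fix i j assume "i < N" "j < N"
  then show "A i j - A i N * A j N / A N N = A j i - A j N * A i N / A N N"
    using A by (simp add: psd_def)
next
  fix v
  define s where "s = (\<Sum>i<N. v i * A i N)"
  \<comment> \<open>The minimiser of the form over the last coordinate.\<close>
  define w where "w = v(N := - s / A N N)"
  have "quad_form N (\<lambda>i j. A i j - A i N * A j N / A N N) v
      = quad_form N A v + (- 1 / A N N) * quad_form N (\<lambda>i j. A i N * A j N) v"
    unfolding quad_form_cmult[symmetric] quad_form_add[symmetric] by simp
  also have "\<dots> = quad_form N A v - s\<^sup>2 / A N N"
    unfolding quad_form_rank_one s_def by simp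
  also have "\<dots> = quad_form (Suc N) A w"
  proof -
    have "quad_form N A w = quad_form N A v" by (simp add: quad_form_def w_def)
    moreover have "(\<Sum>i<N. w i * A i N) = s" by (simp add: w_def s_def)
    ultimately show ?thesis using pos unfolding quad_form_Suc_sym[OF A]
      by (simp add: w_def power2_eq_square field_simps)
  qed
  also have "\<dots> \<ge> 0" using A by (simp add: psd_def)
  finally show "0 \<le> quad_form N (\<lambda>i j. A i j - A i N * A j N / A N N) v" .
qed

lemma psd_diag_nonneg:
  assumes A: "psd (Suc N) A" shows "A N N \<ge> 0"
proof -
  have "quad_form (Suc N) A (\<lambda>i. if i = N then 1 else 0) = A N N"
    by (simp add: quad_form_Suc) (simp add: quad_form_def)
  then show ?thesis using A unfolding psd_def by metis
qed

lemma psd_zero_diag: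
  assumes A: "psd (Suc N) A" and z: "A N N = 0" and k: "k < N"
  shows "A k N = 0"
proof (rule ccontr)
  assume nz: "A k N \<noteq> 0"
  \<comment> \<open>With entry 1 at position \<open>k\<close> and \<open>s\<close> at the end, the quadratic form would take the value -1.\<close>
  define s where "s = - (A k k + 1) / (2 * A k N)"
  define v where "v i = (if i = k then 1 else if i = N then s else 0)" for i
  have vi: "v i * x = (if i = k then x else 0)" if "i < N" for i x
    using that k by (simp add: v_def)
  have pick: "(\<Sum>i<N. v i * x i) = x k" for x
  proof -
    have "(\<Sum>i<N. v i * x i) = (\<Sum>i<N. if i = k then x i else 0)"
      using vi by (intro sum.cong) auto
    then show ?thesis using k by simp
  qed
  have "quad_form N A v = (\<Sum>i<N. v i * (\<Sum>j<N. v j * A i j))"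
    by (simp add: quad_form_def sum_distrib_left mult.assoc)
  then have q: "quad_form N A v = A k k" unfolding pick .
  have "(\<Sum>i<N. v i * A i N) = A k N" by (rule pick)
  moreover have "v N = s" using k by (simp add: v_def)
  ultimately have "quad_form (Suc N) A v = A k k + 2 * s * A k N"
    using q z unfolding quad_form_Suc_sym[OF A] by simp
  also have "\<dots> = -1" using nz by (simp add: s_def field_simps)
  finally have "quad_form (Suc N) A v < 0" by simp
  then show False using A unfolding psd_def by (metis not_less)
qed

text \<open>
  Schur's product theorem. Splitting off the rank one matrix $z z^T$ that agrees with \<open>A\<close> in the last row and
  column leaves the Schur complement, handled by induction; the entrywise product of $z z^T$
  with \<open>B\<close> is the congruence of \<open>B\<close> by the diagonal matrix of $z$. If the last diagonal
  entry of \<open>A\<close> is zero, its last row and column vanish.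
\<close>

theorem psd_hadamard:
  assumes "psd N A" "psd N B"
  shows "psd N (\<lambda>i j. A i j * B i j)"
  using assms
proof (induction N arbitrary: A)
  case (Suc N)
  note A = \<open>psd (Suc N) A\<close> and B = \<open>psd (Suc N) B\<close>
  have "0 \<le> quad_form (Suc N) (\<lambda>i j. A i j * B i j) v" for v
  proof (cases "A N N > 0")
    case True
    define z where "z i = A i N / sqrt (A N N)" for i
    define D where "D i j = A i j - A i N * A j N / A N N" for i j
    have zz: "z i * z j = A i N * A j N / A N N" for i j
      using True by (simp add: z_def)
    have D0: "D i N = 0" "D N i = 0" if "i < Suc N" for i
      using that A True by (auto simp: D_def psd_def)
    have "psd N D" unfolding D_def by (rule psd_schur_complement[OF A True])
    then have "psd N (\<lambda>i j. D i j * B i j)" using Suc.IH psd_minor[OF B] by blast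
    then have 1: "0 \<le> quad_form N (\<lambda>i j. D i j * B i j) v" by (simp add: psd_def)
    have "quad_form (Suc N) (\<lambda>i j. A i j * B i j) v
        = quad_form (Suc N) (\<lambda>i j. D i j * B i j) v + quad_form (Suc N) (\<lambda>i j. z i * z j * B i j) v"
      unfolding quad_form_add[symmetric] zz D_def by (simp add: algebra_simps)
    also have "quad_form (Suc N) (\<lambda>i j. D i j * B i j) v = quad_form N (\<lambda>i j. D i j * B i j) v"
      unfolding quad_form_Suc using D0 by simp
    also have "quad_form (Suc N) (\<lambda>i j. z i * z j * B i j) v = quad_form (Suc N) B (\<lambda>i. v i * z i)"
      unfolding quad_form_def by (simp add: mult_ac)
    finally show ?thesis using 1 B by (simp add: psd_def)
  next
    case False
    then have z: "A N N = 0" using psd_diag_nonneg[OF A] by simp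
    have c: "A k N = 0" "A N k = 0" if "k < N" for k
      using psd_zero_diag[OF A z that] A that by (auto simp: psd_def)
    have "quad_form (Suc N) (\<lambda>i j. A i j * B i j) v = quad_form N (\<lambda>i j. A i j * B i j) v"
      unfolding quad_form_Suc using c z by simp
    also have "psd N (\<lambda>i j. A i j * B i j)" using Suc.IH psd_minor[OF A] psd_minor[OF B] by blast
    then have "0 \<le> quad_form N (\<lambda>i j. A i j * B i j) v" by (simp add: psd_def)
    finally show ?thesis .
  qed
  then show ?case using A B by (simp add: psd_def)
qed (simp add: psd_def quad_form_def)

lemma psd_power:
  assumes "psd N A" shows "psd N (\<lambda>i j. A i j ^ m)"
proof (induction m)
  case 0
  have "quad_form N (\<lambda>i j. 1) v = (\<Sum>i<N. v i)\<^sup>2" for v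
    using quad_form_rank_one[of N "\<lambda>_. 1" v] by simp
  then show ?case by (simp add: psd_def)
next
  case (Suc m)
  then show ?case using psd_hadamard[OF assms Suc] by simp
qed

lemma psd_power_nonneg: "psd N A \<Longrightarrow> 0 \<le> quad_form N (\<lambda>i j. A i j ^ m) v"
  using psd_power by (simp add: psd_def)

lemma quad_form_power_rank_one:
  "quad_form N (\<lambda>i j. (u i * u j) ^ e) v = (\<Sum>i<N. v i * u i ^ e)\<^sup>2"
  unfolding power_mult_distrib by (rule quad_form_rank_one)

section \<open>Dominating one entrywise power by others\<close>

text \<open>
  With $g_e = \sum_i v_i u_i^e$ bounded interpolation gives $g_M = \sum_e a_e g_e$ with
  $|a_e| \le C$, and each $|g_e|$ is at most $\sqrt{R / c_e}$, where $R$ is the right-hand side.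
\<close>

lemma dominated_power_rank_one:
  assumes fin: "finite E" "finite F" and M: "\<And>e. e \<in> E \<Longrightarrow> e < M" "\<And>f. f \<in> F \<Longrightarrow> M < f"
    and card: "N \<le> card E" "N \<le> card F" and c: "\<And>e. e \<in> E \<union> F \<Longrightarrow> c e > (0::real)"
  shows "\<exists>\<delta>>0. \<forall>u v. (\<forall>i<N. u i > 0) \<longrightarrow>
           \<delta> * (\<Sum>i<N. v i * u i ^ M)\<^sup>2 \<le> (\<Sum>e\<in>E \<union> F. c e * (\<Sum>i<N. v i * u i ^ e)\<^sup>2)"
proof -
  obtain C where C: "\<And>U. finite U \<Longrightarrow> U \<subseteq> {0<..} \<Longrightarrow> card U \<le> N \<Longrightarrow>
      \<exists>a. (\<forall>e\<in>E \<union> F. \<bar>a e\<bar> \<le> C) \<and> (\<forall>u\<in>U. u ^ M = (\<Sum>e\<in>E \<union> F. a e * u ^ e :: real))"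
    using bounded_interpolation[OF fin M card] by blast
  define L where "L = (\<Sum>e\<in>E \<union> F. C / sqrt (c e))"
  define K where "K = 1 + L\<^sup>2"
  have K: "K > 0" unfolding K_def by (simp add: add_pos_nonneg)
  have "(1 / K) * (\<Sum>i<N. v i * u i ^ M)\<^sup>2 \<le> (\<Sum>e\<in>E \<union> F. c e * (\<Sum>i<N. v i * u i ^ e)\<^sup>2)"
    if u: "\<forall>i<N. u i > 0" for u v
  proof -
    have "card (u ` {..<N}) \<le> N" using card_image_le[of "{..<N}" u] by simp
    moreover have "u ` {..<N} \<subseteq> {0<..}" using u by auto
    ultimately obtain a where a0: "\<forall>e\<in>E \<union> F. \<bar>a e\<bar> \<le> C"
      "\<forall>x\<in>u ` {..<N}. x ^ M = (\<Sum>e\<in>E \<union> F. a e * x ^ e)"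
      using C[of "u ` {..<N}"] by blast
    define g where "g e = (\<Sum>i<N. v i * u i ^ e)" for e
    define R where "R = (\<Sum>e\<in>E \<union> F. c e * (g e)\<^sup>2)"
    have terms: "0 \<le> c e * (g e)\<^sup>2" if "e \<in> E \<union> F" for e
      using c[OF that] by simp
    have R: "R \<ge> 0" unfolding R_def using terms by (rule sum_nonneg)
    have "g M = (\<Sum>i<N. \<Sum>e\<in>E \<union> F. a e * (v i * u i ^ e))"
      unfolding g_def by (intro sum.cong refl) (simp add: a0(2) sum_distrib_left mult_ac)
    also have "\<dots> = (\<Sum>e\<in>E \<union> F. a e * g e)"
      unfolding g_def sum_distrib_left by (rule sum.swap)
    also have "\<bar>\<dots>\<bar> \<le> (\<Sum>e\<in>E \<union> F. C / sqrt (c e) * sqrt R)"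
    proof (rule order_trans[OF sum_abs sum_mono])
      fix e assume e: "e \<in> E \<union> F"
      have "c e * (g e)\<^sup>2 \<le> R"
        unfolding R_def using e terms fin by (intro member_le_sum) auto
      then have "(g e)\<^sup>2 \<le> R / c e" using c[OF e] by (simp add: field_simps)
      then have "\<bar>g e\<bar> \<le> sqrt R / sqrt (c e)"
        by (metis real_sqrt_abs real_sqrt_divide real_sqrt_le_mono)
      moreover have "\<bar>a e\<bar> \<le> C" using a0(1) e by blast
      ultimately have "\<bar>a e\<bar> * \<bar>g e\<bar> \<le> C * (sqrt R / sqrt (c e))"
        by (intro mult_mono) auto
      then show "\<bar>a e * g e\<bar> \<le> C / sqrt (c e) * sqrt R" by (simp add: abs_mult)
    qed
    finally have "\<bar>g M\<bar> \<le> L * sqrt R" unfolding L_def sum_distrib_right .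
    then have "(g M)\<^sup>2 \<le> (L * sqrt R)\<^sup>2"
      using power_mono[of "\<bar>g M\<bar>" "L * sqrt R" 2] by simp
    also have "\<dots> \<le> K * R" using R by (simp add: K_def power_mult_distrib algebra_simps)
    finally have "(g M)\<^sup>2 \<le> K * R" .
    then show ?thesis using K unfolding g_def R_def by (simp add: field_simps)
  qed
  then show ?thesis using K by (intro exI[of _ "1 / K"]) auto
qed

text \<open>
  The derivative of $\sum_e c_e x^e - \delta x^M$ is of the same shape with all exponents
  lowered by one. At most one exponent is lost, namely 0, so enough exponents remain below $M - 1$ for
  matrices of the next smaller size. There the induction hypothesis makes the derivative along
  the segment from a rank one matrix to \<open>A\<close> nonnegative, for sufficiently small \<open>\<delta>\<close>.
\<close>

theorem dominated_power:
  assumes "finite E" "finite F" "\<And>e. e \<in> E \<Longrightarrow> e < M" "\<And>f. f \<in> F \<Longrightarrow> M < f"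
    and "N \<le> card E" "N \<le> card F" and "\<And>e. e \<in> E \<union> F \<Longrightarrow> c e > (0::real)"
  shows "\<exists>\<delta>>0. \<forall>A v. psd N A \<longrightarrow> (\<forall>i<N. \<forall>j<N. A i j > 0) \<longrightarrow>
           \<delta> * quad_form N (\<lambda>i j. A i j ^ M) v \<le> (\<Sum>e\<in>E \<union> F. c e * quad_form N (\<lambda>i j. A i j ^ e) v)"
  using assms
proof (induction N arbitrary: E F M c)
  case 0
  then show ?case by (intro exI[of _ 1]) (simp add: quad_form_def)
next
  case (Suc N)
  note fin = Suc.prems(1,2) and M = Suc.prems(3,4) and card = Suc.prems(5,6) and c = Suc.prems(7)
  have M0: "M > 0"
  proof -
    have "E \<noteq> {}" using card by auto
    then obtain e where "e \<in> E" by blast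
    then show ?thesis using M(1)[of e] by simp
  qed
  define pre where "pre S = (\<lambda>e. e - 1) ` (S - {0})" for S :: "nat set"
  have inj: "inj_on (\<lambda>e. e - 1) (S - {0})" for S :: "nat set" by (auto simp: inj_on_def)
  have cpre: "N \<le> card (pre S)" if "finite S" "Suc N \<le> card S" for S
  proof -
    have "card (pre S) = card (S - {0})" unfolding pre_def by (rule card_image[OF inj])
    then show ?thesis using that card_Diff1_le by (cases "0 \<in> S") auto
  qed
  have pre_Un: "pre (E \<union> F) = pre E \<union> pre F" unfolding pre_def by auto
  \<comment> \<open>The weights in the derivative of the positive part.\<close>
  define c' where "c' e = (real e + 1) * c (e + 1)" for e
  have "\<exists>\<delta>>0. \<forall>A v. psd N A \<longrightarrow> (\<forall>i<N. \<forall>j<N. A i j > 0) \<longrightarrow>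
      \<delta> * quad_form N (\<lambda>i j. A i j ^ (M - 1)) v
        \<le> (\<Sum>e\<in>pre E \<union> pre F. c' e * quad_form N (\<lambda>i j. A i j ^ e) v)"
  proof (rule Suc.IH)
    show "finite (pre E)" "finite (pre F)" using fin by (simp_all add: pre_def)
    show "N \<le> card (pre E)" "N \<le> card (pre F)" using cpre fin card by simp_all
    show "e < M - 1" if "e \<in> pre E" for e
      using that M(1) unfolding pre_def by (auto intro!: diff_less_mono simp: Suc_le_eq)
    show "M - 1 < f" if "f \<in> pre F" for f
      using that M(2) M0 unfolding pre_def by (auto intro!: diff_less_mono simp: Suc_le_eq)
    show "c' e > 0" if "e \<in> pre E \<union> pre F" for e
    proof -
      obtain x where "x \<in> E \<union> F" "x \<noteq> 0" "e = x - 1"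
        using \<open>e \<in> pre E \<union> pre F\<close> by (auto simp: pre_def)
      then have "e + 1 \<in> E \<union> F" by simp
      then show ?thesis using c by (simp add: c'_def)
    qed
  qed
  then obtain \<delta>2 where \<delta>2: "\<delta>2 > 0" "\<And>A v. psd N A \<Longrightarrow> (\<forall>i<N. \<forall>j<N. A i j > 0) \<Longrightarrow>
      \<delta>2 * quad_form N (\<lambda>i j. A i j ^ (M - 1)) v
        \<le> (\<Sum>e\<in>pre (E \<union> F). c' e * quad_form N (\<lambda>i j. A i j ^ e) v)"
    unfolding pre_Un by blast
  obtain \<delta>1 where \<delta>1: "\<delta>1 > 0" "\<And>u v. (\<forall>i<Suc N. u i > 0) \<Longrightarrow>
      \<delta>1 * (\<Sum>i<Suc N. v i * u i ^ M)\<^sup>2 \<le> (\<Sum>e\<in>E \<union> F. c e * (\<Sum>i<Suc N. v i * u i ^ e)\<^sup>2)"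
  proof -
    have "\<exists>\<delta>>0. \<forall>u v. (\<forall>i<Suc N. u i > 0) \<longrightarrow>
        \<delta> * (\<Sum>i<Suc N. v i * u i ^ M)\<^sup>2 \<le> (\<Sum>e\<in>E \<union> F. c e * (\<Sum>i<Suc N. v i * u i ^ e)\<^sup>2)"
      by (rule dominated_power_rank_one) (use fin M card c in auto)
    then show ?thesis using that by blast
  qed
  define \<delta> where "\<delta> = min \<delta>1 (\<delta>2 / real M)"
  have \<delta>: "\<delta> > 0" "\<delta> \<le> \<delta>1" "real M * \<delta> \<le> \<delta>2"
  proof -
    show "\<delta> > 0" "\<delta> \<le> \<delta>1" using \<delta>1(1) \<delta>2(1) M0 by (simp_all add: \<delta>_def)
    have "\<delta> \<le> \<delta>2 / real M" by (simp add: \<delta>_def)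
    then show "real M * \<delta> \<le> \<delta>2" using M0 by (simp add: pos_le_divide_eq mult.commute)
  qed
  define g where "g x = (\<Sum>e\<in>E \<union> F. c e * x ^ e) - \<delta> * x ^ M" for x :: real
  define g' where "g' x = (\<Sum>e\<in>E \<union> F. c e * (real e * x ^ (e - 1))) - \<delta> * (real M * x ^ (M - 1))"
    for x :: real
  have power_deriv: "((\<lambda>x. x ^ k) has_real_derivative real k * x ^ (k - 1)) (at x)" for k x
    using DERIV_pow[of k x] by simp
  have deriv: "(g has_real_derivative g' x) (at x)" for x
    unfolding g_def g'_def
    by (intro DERIV_diff DERIV_sum DERIV_cmult power_deriv)
  have g_form: "quad_form K (\<lambda>i j. g (A i j)) v
      = (\<Sum>e\<in>E \<union> F. c e * quad_form K (\<lambda>i j. A i j ^ e) v) - \<delta> * quad_form K (\<lambda>i j. A i j ^ M) v"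
    for K A v
    using quad_form_add[of K "\<lambda>i j. \<Sum>e\<in>E \<union> F. c e * A i j ^ e" "\<lambda>i j. - \<delta> * A i j ^ M" v]
    unfolding g_def quad_form_sum quad_form_cmult by simp
  have g'_psd: "psd N (\<lambda>i j. g' (A i j))"
    if A: "psd N A" "\<forall>i<N. \<forall>j<N. A i j > 0" for A
    unfolding psd_def
  proof (intro conjI allI impI)
    fix v
    let ?q = "\<lambda>e. quad_form N (\<lambda>i j. A i j ^ e) v"
    have "quad_form N (\<lambda>i j. g' (A i j)) v
        = (\<Sum>e\<in>E \<union> F. c e * (real e * ?q (e - 1))) - \<delta> * (real M * ?q (M - 1))"
      using quad_form_add[of N "\<lambda>i j. \<Sum>e\<in>E \<union> F. c e * (real e * A i j ^ (e - 1))"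
          "\<lambda>i j. - \<delta> * (real M * A i j ^ (M - 1))" v]
      unfolding g'_def quad_form_sum quad_form_cmult by simp
    also have "(\<Sum>e\<in>E \<union> F. c e * (real e * ?q (e - 1)))
        = (\<Sum>e\<in>(E \<union> F) - {0}. c e * (real e * ?q (e - 1)))"
      using fin by (intro sum.mono_neutral_right) auto
    also have "\<dots> = (\<Sum>e\<in>(E \<union> F) - {0}. c' (e - 1) * ?q (e - 1))"
      by (intro sum.cong) (auto simp: c'_def of_nat_diff)
    also have "\<dots> = (\<Sum>e\<in>pre (E \<union> F). c' e * ?q e)"
      unfolding pre_def by (subst sum.reindex[OF inj]) simp
    finally have eq: "quad_form N (\<lambda>i j. g' (A i j)) v
        = (\<Sum>e\<in>pre (E \<union> F). c' e * ?q e) - real M * \<delta> * ?q (M - 1)" by simp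
    have "real M * \<delta> * ?q (M - 1) \<le> \<delta>2 * ?q (M - 1)"
      using \<delta>(3) psd_power_nonneg[OF A(1)] by (rule mult_right_mono)
    then show "0 \<le> quad_form N (\<lambda>i j. g' (A i j)) v"
      unfolding eq using \<delta>2(2)[OF A, of v] by linarith
  next
    fix i j assume "i < N" "j < N"
    then have "A i j = A j i" using A by (simp add: psd_def)
    then show "g' (A i j) = g' (A j i)" by simp
  qed
  have "0 \<le> quad_form (Suc N) (\<lambda>i j. g (A i j)) v"
    if A: "psd (Suc N) A" and pos: "\<forall>i<Suc N. \<forall>j<Suc N. A i j > 0" for A v
  proof -
    have a: "A N N > 0" using pos by simp
    define z where "z i = A i N / sqrt (A N N)" for i
    define D where "D i j = A i j - A i N * A j N / A N N" for i j
    have zz: "z i * z j = A i N * A j N / A N N" for i j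
      using a by (simp add: z_def)
    have zpos: "z i > 0" if "i < Suc N" for i
      using pos that by (simp add: z_def)
    have D0: "D i N = 0" "D N i = 0" if "i < Suc N" for i
      using that A a by (auto simp: D_def psd_def)
    have Dpsd: "psd N D" unfolding D_def by (rule psd_schur_complement[OF A a])
    \<comment> \<open>The segment from the rank one matrix to \<open>A\<close>; it fixes the last row and column.\<close>
    define X where "X t i j = z i * z j + t * D i j" for t i j
    define \<phi> where "\<phi> t = quad_form (Suc N) (\<lambda>i j. g (X t i j)) v" for t
    define \<phi>' where "\<phi>' t = quad_form (Suc N) (\<lambda>i j. g' (X t i j) * D i j) v" for t
    have "((\<lambda>t. g (X t i j)) has_real_derivative g' (X t i j) * D i j) (at t)" for i j t
      unfolding X_def by (rule DERIV_chain2[OF deriv]) (auto intro!: derivative_eq_intros)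
    then have \<phi>_deriv: "(\<phi> has_real_derivative \<phi>' t) (at t)" for t
      unfolding \<phi>_def \<phi>'_def quad_form_def by (intro DERIV_sum DERIV_cmult)
    have \<phi>'_nonneg: "\<phi>' t \<ge> 0" if t: "0 \<le> t" "t \<le> 1" for t
    proof -
      have Xpos: "\<forall>i<N. \<forall>j<N. X t i j > 0"
      proof (intro allI impI)
        fix i j assume ij: "i < N" "j < N"
        have "A i j = z i * z j + D i j" by (simp add: D_def zz)
        then have "X t i j = (1 - t) * (z i * z j) + t * A i j"
          by (simp add: X_def algebra_simps)
        moreover have "z i * z j > 0" "A i j > 0" using zpos pos ij by simp_all
        ultimately show "X t i j > 0"
          using t by (cases "t = 0") (simp_all add: add_nonneg_pos)
      qed
      have "psd N (X t)"
        unfolding psd_def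
      proof (intro conjI allI impI)
        fix w
        have "quad_form N (X t) w = (\<Sum>i<N. w i * z i)\<^sup>2 + t * quad_form N D w"
          unfolding X_def quad_form_add quad_form_cmult quad_form_rank_one ..
        then show "0 \<le> quad_form N (X t) w" using t Dpsd by (simp add: psd_def)
      next
        fix i j assume "i < N" "j < N"
        then have "D i j = D j i" using Dpsd by (simp add: psd_def)
        then show "X t i j = X t j i" by (metis X_def mult.commute)
      qed
      then have "psd N (\<lambda>i j. g' (X t i j) * D i j)"
        using psd_hadamard g'_psd Xpos Dpsd by blast
      moreover have "\<phi>' t = quad_form N (\<lambda>i j. g' (X t i j) * D i j) v"
        unfolding \<phi>'_def quad_form_Suc by (simp add: D0)
      ultimately show ?thesis by (simp add: psd_def)
    qed
    have "\<phi> 0 \<le> \<phi> 1"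
      by (rule DERIV_nonneg_imp_nondecreasing[OF zero_le_one]) (meson \<phi>_deriv \<phi>'_nonneg)
    moreover have "\<phi> 1 = quad_form (Suc N) (\<lambda>i j. g (A i j)) v"
      unfolding \<phi>_def by (intro quad_form_cong) (simp add: X_def D_def zz)
    moreover have "0 \<le> \<phi> 0"
    proof -
      have "\<delta> * (\<Sum>i<Suc N. v i * z i ^ M)\<^sup>2 \<le> \<delta>1 * (\<Sum>i<Suc N. v i * z i ^ M)\<^sup>2"
        using \<delta>(2) by (rule mult_right_mono) simp
      also have "\<dots> \<le> (\<Sum>e\<in>E \<union> F. c e * (\<Sum>i<Suc N. v i * z i ^ e)\<^sup>2)"
        by (rule \<delta>1(2)) (use zpos in blast)
      finally show ?thesis
        unfolding \<phi>_def g_form X_def mult_zero_left add_0_right quad_form_power_rank_one by linarith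
    qed
    ultimately show ?thesis by simp
  qed
  then show ?case using \<delta>(1) unfolding g_form by (intro exI[of _ \<delta>]) simp
qed

section \<open>A convergent series with prescribed signs\<close>

lemma quad_form_sums:
  assumes "\<And>i j. i < N \<Longrightarrow> j < N \<Longrightarrow> summable (\<lambda>m. B m i j)"
  shows "(\<lambda>m. quad_form N (B m) v) sums quad_form N (\<lambda>i j. \<Sum>m. B m i j) v"
  unfolding quad_form_def using assms
  by (intro sums_sum sums_mult summable_sums) auto

lemma summable_dominated_by_exp:
  fixes b :: "nat \<Rightarrow> real"
  assumes "\<And>m. \<bar>b m\<bar> \<le> 1 / fact m"
  shows "summable (\<lambda>m. b m * x ^ m)"
proof (rule summable_comparison_test[OF _ summable_exp[of "\<bar>x\<bar>"]])
  have "norm (b m * x ^ m) \<le> inverse (fact m) * \<bar>x\<bar> ^ m" for m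
    using mult_right_mono[OF assms[of m], of "\<bar>x\<bar> ^ m"]
    by (simp add: abs_mult power_abs divide_inverse)
  then show "\<exists>k. \<forall>m\<ge>k. norm (b m * x ^ m) \<le> inverse (fact m) * \<bar>x\<bar> ^ m" by blast
qed

text \<open>
  Positive coefficients are $1/m!$, negative ones are as large in absolute value as domination
  allows, but at most $1/m!$. The exponent \<open>M\<close> may use up the fraction \<open>w M\<close> of the
  initial terms and of the positive coefficients; these fractions add up to 1.
\<close>

theorem sign_pattern_series:
  fixes c :: "nat \<Rightarrow> real" and \<epsilon> :: "nat \<Rightarrow> int"
  assumes E: "finite E" "N \<le> card E" "\<And>e. e \<in> E \<Longrightarrow> e \<le> K" "\<And>e. e \<in> E \<Longrightarrow> c e > 0"
    and sgn: "\<And>M. M > K \<Longrightarrow> \<epsilon> M \<in> {-1, 0, 1}"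
    and later: "\<And>M. M > K \<Longrightarrow> \<epsilon> M = -1 \<Longrightarrow>
           \<exists>S. finite S \<and> card S \<ge> N \<and> (\<forall>m \<in> S. m > M \<and> \<epsilon> m = 1)"
  shows "\<exists>b :: nat \<Rightarrow> real. (\<forall>m\<le>K. b m = 0) \<and> (\<forall>m. \<bar>b m\<bar> \<le> 1 / fact m) \<and>
    (\<forall>m>K. sgn (b m) = of_int (\<epsilon> m)) \<and>
    (\<forall>A v. psd N A \<longrightarrow> (\<forall>i<N. \<forall>j<N. A i j > 0) \<longrightarrow>
       0 \<le> (\<Sum>e\<in>E. c e * quad_form N (\<lambda>i j. A i j ^ e) v)
           + (\<Sum>m. b m * quad_form N (\<lambda>i j. A i j ^ m) v))"
proof -
  define w :: "nat \<Rightarrow> real" where "w M = (1 / 2) ^ Suc M" for M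
  have w0: "w M > 0" for M by (simp add: w_def)
  have w1: "w sums 1" unfolding w_def by (rule power_half_series)
  define c' where "c' e = (if e \<in> E then c e else 1 / fact e)" for e
  have c'0: "c' e > 0" for e using E(4) by (simp add: c'_def)
  define good where "good M S \<delta> \<longleftrightarrow> finite S \<and> (\<forall>m\<in>S. m > M \<and> \<epsilon> m = 1) \<and> \<delta> > 0 \<and>
      (\<forall>A v. psd N A \<longrightarrow> (\<forall>i<N. \<forall>j<N. A i j > 0) \<longrightarrow>
         \<delta> * quad_form N (\<lambda>i j. A i j ^ M) v
           \<le> (\<Sum>e\<in>E \<union> S. w M * c' e * quad_form N (\<lambda>i j. A i j ^ e) v))" for M S \<delta>
  have "\<exists>S \<delta>. good M S \<delta>" if M: "M > K" "\<epsilon> M = -1" for M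
  proof -
    obtain S where S: "finite S" "card S \<ge> N" "\<forall>m\<in>S. m > M \<and> \<epsilon> m = 1"
      using later[OF M] by blast
    have "\<exists>\<delta>>0. \<forall>A v. psd N A \<longrightarrow> (\<forall>i<N. \<forall>j<N. A i j > 0) \<longrightarrow>
        \<delta> * quad_form N (\<lambda>i j. A i j ^ M) v
          \<le> (\<Sum>e\<in>E \<union> S. w M * c' e * quad_form N (\<lambda>i j. A i j ^ e) v)"
    proof (rule dominated_power)
      show "e < M" if "e \<in> E" for e using E(3)[OF that] M(1) by (rule le_less_trans)
    qed (use E S w0 c'0 in auto)
    then show ?thesis using S unfolding good_def by blast
  qed
  then obtain S \<delta> where good: "\<And>M. M > K \<Longrightarrow> \<epsilon> M = -1 \<Longrightarrow> good M (S M) (\<delta> M)"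
    by metis
  define p where "p m = (if m > K \<and> \<epsilon> m = 1 then 1 / fact m else 0 :: real)" for m
  define r where "r m = (if m > K \<and> \<epsilon> m = -1 then min (\<delta> m) (1 / fact m) else 0 :: real)" for m
  have \<delta>0: "\<delta> m > 0" if "m > K" "\<epsilon> m = -1" for m using good[OF that] by (simp add: good_def)
  have p0: "0 \<le> p m" "\<bar>p m\<bar> \<le> 1 / fact m" for m by (simp_all add: p_def)
  have r0: "0 \<le> r m" "\<bar>r m\<bar> \<le> 1 / fact m" for m
    using \<delta>0[of m] by (auto simp: r_def min_def)
  show ?thesis
  proof (intro exI[of _ "\<lambda>m. p m - r m"] conjI allI impI)
    fix m assume "m \<le> K"
    then show "p m - r m = 0" by (simp add: p_def r_def)
  next
    fix m
    show "\<bar>p m - r m\<bar> \<le> 1 / fact m"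
      using p0[of m] r0[of m] by (cases "\<epsilon> m = 1") (auto simp: p_def r_def)
  next
    fix m assume m: "m > K"
    consider "\<epsilon> m = 1" | "\<epsilon> m = 0" | "\<epsilon> m = -1" using sgn[OF m] by auto
    then show "sgn (p m - r m) = of_int (\<epsilon> m)"
      using \<delta>0[OF m] m by cases (simp_all add: p_def r_def sgn_if min_def)
  next
    fix A v assume A: "psd N A" and pos: "\<forall>i<N. \<forall>j<N. A i j > 0"
    define Q where "Q m = quad_form N (\<lambda>i j. A i j ^ m) v" for m
    have Q0: "Q m \<ge> 0" for m unfolding Q_def by (rule psd_power_nonneg[OF A])
    have summ: "summable (\<lambda>m. b m * Q m)" if b: "\<And>m. \<bar>b m\<bar> \<le> 1 / fact m" for b
    proof -
      have "(\<lambda>m. quad_form N (\<lambda>i j. b m * A i j ^ m) v)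
          sums quad_form N (\<lambda>i j. \<Sum>m. b m * A i j ^ m) v"
        by (rule quad_form_sums) (rule summable_dominated_by_exp[OF b])
      then show ?thesis unfolding quad_form_cmult Q_def by (rule sums_summable)
    qed
    have sp: "summable (\<lambda>m. p m * Q m)" and sr: "summable (\<lambda>m. r m * Q m)"
      using p0(2) r0(2) by (auto intro: summ)
    define T where "T = (\<Sum>e\<in>E. c e * Q e)"
    define P where "P = (\<Sum>m. p m * Q m)"
    have TP: "0 \<le> T + P"
      unfolding T_def P_def using E(4) Q0 p0 sp
      by (intro add_nonneg_nonneg sum_nonneg suminf_nonneg mult_nonneg_nonneg) (auto intro: less_imp_le)
    have le: "r M * Q M \<le> w M * (T + P)" for M
    proof (cases "M > K \<and> \<epsilon> M = -1")
      case True
      then have g: "good M (S M) (\<delta> M)" using good by blast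
      have S: "finite (S M)" "\<And>m. m \<in> S M \<Longrightarrow> m > K \<and> \<epsilon> m = 1"
        using g True unfolding good_def by (auto intro: less_trans)
      have disj: "E \<inter> S M = {}" using S(2) E(3) by force
      have "r M * Q M \<le> \<delta> M * Q M"
        using Q0 True by (intro mult_right_mono) (auto simp: r_def)
      also have "\<dots> \<le> (\<Sum>e\<in>E \<union> S M. w M * c' e * Q e)"
        using g A pos unfolding good_def Q_def by blast
      also have "\<dots> = w M * (\<Sum>e\<in>E \<union> S M. c' e * Q e)"
        by (simp add: sum_distrib_left mult.assoc)
      also have "(\<Sum>e\<in>E \<union> S M. c' e * Q e) = T + (\<Sum>e\<in>S M. p e * Q e)"
      proof -
        have "(\<Sum>e\<in>E. c' e * Q e) = T" unfolding T_def by (simp add: c'_def)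
        moreover have "(\<Sum>e\<in>S M. c' e * Q e) = (\<Sum>e\<in>S M. p e * Q e)"
          using S(2) disj by (intro sum.cong) (auto simp: c'_def p_def)
        ultimately show ?thesis using E(1) S(1) disj by (simp add: sum.union_disjoint)
      qed
      also have "w M * (T + (\<Sum>e\<in>S M. p e * Q e)) \<le> w M * (T + P)"
        unfolding P_def using w0[of M] p0 Q0 S(1) sp
        by (intro mult_left_mono add_left_mono sum_le_suminf) auto
      finally show ?thesis .
    next
      case False
      then have "r M = 0" by (auto simp: r_def)
      then show ?thesis using TP w0[of M] by simp
    qed
    have "(\<Sum>m. r m * Q m) \<le> (\<Sum>m. w m * (T + P))"
      using w1 by (intro suminf_le le sr summable_mult2) (rule sums_summable)
    also have "\<dots> = T + P"
      using sums_mult2[OF w1, of "T + P"] by (simp add: sums_iff)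
    also have "P = (\<Sum>m. (p m - r m) * Q m) + (\<Sum>m. r m * Q m)"
      unfolding P_def left_diff_distrib using suminf_diff[OF sp sr] by simp
    finally show "0 \<le> (\<Sum>e\<in>E. c e * quad_form N (\<lambda>i j. A i j ^ e) v)
        + (\<Sum>m. (p m - r m) * quad_form N (\<lambda>i j. A i j ^ m) v)"
      unfolding T_def Q_def by simp
  qed
qed

section \<open>Complex matrices with real entries\<close>

lemma mat_adjoint_eq_self_iff:
  assumes A: "A \<in> carrier_mat N N"
  shows "mat_adjoint A = A \<longleftrightarrow> (\<forall>i<N. \<forall>j<N. A $$ (i, j) = cnj (A $$ (j, i)))"
proof -
  have dims: "dim_row (mat_adjoint A) = N" "dim_col (mat_adjoint A) = N"
    using A by (auto simp: mat_adjoint_def)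
  have idx: "mat_adjoint A $$ (i, j) = cnj (A $$ (j, i))" if "i < N" "j < N" for i j
    using A that by (simp add: mat_adjoint_def mat_of_rows_index conjugate_complex_def)
  show ?thesis
  proof
    assume h: "mat_adjoint A = A"
    show "\<forall>i<N. \<forall>j<N. A $$ (i, j) = cnj (A $$ (j, i))"
      using idx[unfolded h] by blast
  next
    assume h: "\<forall>i<N. \<forall>j<N. A $$ (i, j) = cnj (A $$ (j, i))"
    show "mat_adjoint A = A"
    proof (rule eq_matI)
      fix i j assume "i < dim_row A" "j < dim_col A"
      then have ij: "i < N" "j < N" using A by auto
      show "mat_adjoint A $$ (i, j) = A $$ (i, j)"
        unfolding idx[OF ij] by (rule h[rule_format, OF ij, symmetric])
    qed (use A dims in auto)
  qed
qed

lemma complex_of_real_nonneg_iff: "0 \<le> complex_of_real x \<longleftrightarrow> 0 \<le> x"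
  by (simp add: less_eq_complex_def)

text \<open>
  The mixed products of real and imaginary parts cancel because the matrix is symmetric.
\<close>

lemma hermitian_form_real:
  assumes A: "A \<in> carrier_mat N N" and a: "\<And>i j. i < N \<Longrightarrow> j < N \<Longrightarrow> A $$ (i, j) = complex_of_real (a i j)"
    and sym: "\<And>i j. i < N \<Longrightarrow> j < N \<Longrightarrow> a i j = a j i" and v: "v \<in> carrier_vec N"
  shows "(A *\<^sub>v v) \<bullet>c v =
    complex_of_real (quad_form N a (\<lambda>i. Re (v $ i)) + quad_form N a (\<lambda>i. Im (v $ i)))"
proof -
  have "(A *\<^sub>v v) \<bullet>c v = (\<Sum>i<N. (\<Sum>j<N. A $$ (i, j) * v $ j) * cnj (v $ i))"
    using A v by (simp add: scalar_prod_def conjugate_complex_def atLeast0LessThan)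
  also have "\<dots> = (\<Sum>i<N. \<Sum>j<N. complex_of_real (a i j) * (v $ j * cnj (v $ i)))"
    by (intro sum.cong refl) (simp add: a sum_distrib_right mult.assoc)
  finally have eq: "(A *\<^sub>v v) \<bullet>c v = (\<Sum>i<N. \<Sum>j<N. complex_of_real (a i j) * (v $ j * cnj (v $ i)))" .
  have Re_term: "Re (complex_of_real r * (x * cnj y)) = Re y * Re x * r + Im y * Im x * r"
    and Im_term: "Im (complex_of_real r * (x * cnj y)) = r * (Im x * Re y) - r * (Re x * Im y)"
    for r x y by (simp_all add: algebra_simps)
  have "(\<Sum>i<N. \<Sum>j<N. a i j * (Im (v $ j) * Re (v $ i)))
      = (\<Sum>j<N. \<Sum>i<N. a i j * (Im (v $ j) * Re (v $ i)))" by (rule sum.swap)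
  also have "\<dots> = (\<Sum>i<N. \<Sum>j<N. a i j * (Re (v $ j) * Im (v $ i)))"
  proof (intro sum.cong refl)
    fix i j assume "i \<in> {..<N}" "j \<in> {..<N}"
    then have "a j i = a i j" using sym by auto
    then show "a j i * (Im (v $ i) * Re (v $ j)) = a i j * (Re (v $ j) * Im (v $ i))"
      by (simp only: mult.commute)
  qed
  finally have "Im ((A *\<^sub>v v) \<bullet>c v) = 0"
    unfolding eq Im_sum Im_term sum_subtractf by simp
  moreover have "Re ((A *\<^sub>v v) \<bullet>c v)
      = quad_form N a (\<lambda>i. Re (v $ i)) + quad_form N a (\<lambda>i. Im (v $ i))"
    unfolding eq Re_sum Re_term quad_form_def sum.distrib ..
  ultimately show ?thesis by (simp add: complex_eq_iff)
qed

lemma psd_mat_iff_psd: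
  assumes A: "A \<in> carrier_mat N N" and a: "\<And>i j. i < N \<Longrightarrow> j < N \<Longrightarrow> A $$ (i, j) = complex_of_real (a i j)"
  shows "psd_mat N A \<longleftrightarrow> psd N a"
proof -
  define symmetric where "symmetric \<longleftrightarrow> (\<forall>i<N. \<forall>j<N. a i j = a j i)"
  have "mat_adjoint A = A \<longleftrightarrow> symmetric"
    unfolding mat_adjoint_eq_self_iff[OF A] symmetric_def using a by (metis complex_cnj_complex_of_real of_real_eq_iff)
  moreover have "(\<forall>v\<in>carrier_vec N. 0 \<le> (A *\<^sub>v v) \<bullet>c v) \<longleftrightarrow> (\<forall>v. 0 \<le> quad_form N a v)"
    if symmetric
  proof -
    have form: "(A *\<^sub>v v) \<bullet>c v =
        complex_of_real (quad_form N a (\<lambda>i. Re (v $ i)) + quad_form N a (\<lambda>i. Im (v $ i)))"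
      if v: "v \<in> carrier_vec N" for v
    proof (rule hermitian_form_real[OF A _ _ v])
      show "A $$ (i, j) = complex_of_real (a i j)" if "i < N" "j < N" for i j
        using that by (rule a)
      show "a i j = a j i" if "i < N" "j < N" for i j
        using \<open>symmetric\<close> that unfolding symmetric_def by blast
    qed
    show ?thesis
    proof (intro iffI allI ballI)
      fix v assume *: "\<forall>v\<in>carrier_vec N. 0 \<le> (A *\<^sub>v v) \<bullet>c v"
      define w where "w = vec N (\<lambda>i. complex_of_real (v i))"
      have w: "w \<in> carrier_vec N" by (simp add: w_def)
      have "quad_form N a (\<lambda>i. Re (w $ i)) = quad_form N a v"
        "quad_form N a (\<lambda>i. Im (w $ i)) = 0"
        by (simp_all add: quad_form_def w_def)
      then have "(A *\<^sub>v w) \<bullet>c w = complex_of_real (quad_form N a v)"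
        unfolding form[OF w] by simp
      moreover have "0 \<le> (A *\<^sub>v w) \<bullet>c w" using * w by blast
      ultimately show "0 \<le> quad_form N a v" by (simp only: complex_of_real_nonneg_iff)
    next
      fix v :: "complex vec" assume *: "\<forall>v. 0 \<le> quad_form N a v" and v: "v \<in> carrier_vec N"
      show "0 \<le> (A *\<^sub>v v) \<bullet>c v"
        unfolding form[OF v] complex_of_real_nonneg_iff by (rule add_nonneg_nonneg) (rule *[rule_format])+
    qed
  qed
  ultimately show ?thesis
    unfolding psd_mat_def psd_def symmetric_def[symmetric] using A by blast
qed

section \<open>Positivity preservers with a prescribed sign pattern\<close>

theorem theorem1p9:
  fixes N :: nat and n :: "nat \<Rightarrow> nat" and \<epsilon> :: "nat \<Rightarrow> int" and c :: "nat \<Rightarrow> real"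
  assumes "N > 0"
    and "strict_mono_on {..<N} n"
    and "\<And>M. M > n (N - 1) \<Longrightarrow> \<epsilon> M \<in> {-1, 0, 1}"
    and "\<And>M0. M0 > n (N - 1) \<Longrightarrow> \<epsilon> M0 = -1 \<Longrightarrow>
           \<exists>S. finite S \<and> card S \<ge> N \<and> (\<forall>M \<in> S. M > M0 \<and> \<epsilon> M = 1)"
    and "\<And>i. i < N \<Longrightarrow> c (n i) > 0"
  shows "\<exists>(d :: nat \<Rightarrow> real) (f :: complex \<Rightarrow> complex).
           (\<forall>x :: real. x > 0 \<longrightarrow>
              summable (\<lambda>M. if M > n (N - 1) then d M * x ^ M else 0) \<and>
              f (complex_of_real x) = complex_of_real
                ((\<Sum>i<N. c (n i) * x ^ n i) + (\<Sum>M. if M > n (N - 1) then d M * x ^ M else 0))) \<and>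
           entrywise_positivity_preserver N (complex_of_real ` {0<..}) f \<and>
           (\<forall>M > n (N - 1). sgn (d M) = real_of_int (\<epsilon> M))"
proof -
  define K where "K = n (N - 1)"
  define E where "E = n ` {..<N}"
  have inj: "inj_on n {..<N}" using assms(2) by (rule strict_mono_on_imp_inj_on)
  have E: "finite E" "N \<le> card E" unfolding E_def using inj by (simp_all add: card_image)
  have EK: "e \<le> K" if "e \<in> E" for e
  proof -
    obtain i where i: "i < N" "e = n i" using \<open>e \<in> E\<close> unfolding E_def by blast
    then have "i \<le> N - 1" by simp
    then show ?thesis
      using strict_mono_onD[OF assms(2), of i "N - 1"] i assms(1) unfolding K_def
      by (cases "i = N - 1") auto
  qed
  have Ec: "c e > 0" if "e \<in> E" for e using that assms(5) unfolding E_def by blast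
  have "\<exists>b :: nat \<Rightarrow> real. (\<forall>m\<le>K. b m = 0) \<and> (\<forall>m. \<bar>b m\<bar> \<le> 1 / fact m) \<and>
    (\<forall>m>K. sgn (b m) = of_int (\<epsilon> m)) \<and>
    (\<forall>A v. psd N A \<longrightarrow> (\<forall>i<N. \<forall>j<N. A i j > 0) \<longrightarrow>
       0 \<le> (\<Sum>e\<in>E. c e * quad_form N (\<lambda>i j. A i j ^ e) v)
           + (\<Sum>m. b m * quad_form N (\<lambda>i j. A i j ^ m) v))"
    by (rule sign_pattern_series) (fact E EK Ec assms(3,4)[folded K_def])+
  then obtain b :: "nat \<Rightarrow> real" where b: "\<forall>m\<le>K. b m = 0" "\<forall>m. \<bar>b m\<bar> \<le> 1 / fact m"
    "\<forall>m>K. sgn (b m) = of_int (\<epsilon> m)"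
    "\<forall>A v. psd N A \<longrightarrow> (\<forall>i<N. \<forall>j<N. A i j > 0) \<longrightarrow>
       0 \<le> (\<Sum>e\<in>E. c e * quad_form N (\<lambda>i j. A i j ^ e) v)
           + (\<Sum>m. b m * quad_form N (\<lambda>i j. A i j ^ m) v)"
    by (elim exE conjE) (rule that)
  define F where "F x = (\<Sum>e\<in>E. c e * x ^ e) + (\<Sum>m. b m * x ^ m)" for x :: real
  define f where "f z = complex_of_real (F (Re z))" for z
  have series: "(\<lambda>M. if M > n (N - 1) then b M * x ^ M else 0) = (\<lambda>M. b M * x ^ M)" for x
    using b(1) unfolding K_def by (auto simp: fun_eq_iff not_less)
  have summ: "summable (\<lambda>M. b M * x ^ M)" for x
    by (rule summable_dominated_by_exp[OF b(2)[rule_format]])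
  have "(\<Sum>i<N. c (n i) * x ^ n i) = (\<Sum>e\<in>E. c e * x ^ e)" for x
    unfolding E_def by (subst sum.reindex[OF inj]) simp
  then have f_eq: "f (complex_of_real x) = complex_of_real
      ((\<Sum>i<N. c (n i) * x ^ n i) + (\<Sum>M. if M > n (N - 1) then b M * x ^ M else 0))" for x
    unfolding series f_def F_def by simp
  have F_form: "0 \<le> quad_form N (\<lambda>i j. F (A i j)) v"
    if A: "psd N A" "\<forall>i<N. \<forall>j<N. A i j > 0" for A v
  proof -
    have "(\<lambda>m. quad_form N (\<lambda>i j. b m * A i j ^ m) v)
        sums quad_form N (\<lambda>i j. \<Sum>m. b m * A i j ^ m) v"
      by (rule quad_form_sums) (rule summ)
    then have "quad_form N (\<lambda>i j. \<Sum>m. b m * A i j ^ m) v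
        = (\<Sum>m. b m * quad_form N (\<lambda>i j. A i j ^ m) v)"
      unfolding quad_form_cmult by (simp add: sums_iff)
    then show ?thesis
      using b(4)[rule_format, of A v] A unfolding F_def quad_form_add quad_form_sum quad_form_cmult by simp
  qed
  have "entrywise_positivity_preserver N (complex_of_real ` {0<..}) f"
    unfolding entrywise_positivity_preserver_def
  proof
    fix A assume "A \<in> psd_mats_on N (complex_of_real ` {0<..})"
    then have A: "psd_mat N A" "elements_mat A \<subseteq> complex_of_real ` {0<..}"
      by (auto simp: psd_mats_on_def)
    then have carr: "A \<in> carrier_mat N N" by (simp add: psd_mat_def)
    define a where "a i j = Re (A $$ (i, j))" for i j
    have a: "A $$ (i, j) = complex_of_real (a i j)" "a i j > 0" if "i < N" "j < N" for i j
    proof -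
      have "A $$ (i, j) \<in> elements_mat A" using elements_matI[OF carr that refl] .
      then obtain x where "A $$ (i, j) = complex_of_real x" "x > 0" using A(2) by auto
      then show "A $$ (i, j) = complex_of_real (a i j)" "a i j > 0" by (simp_all add: a_def)
    qed
    have "psd N a" using A(1) psd_mat_iff_psd[OF carr a(1)] by simp
    then have "psd N (\<lambda>i j. F (a i j))" using F_form a(2) unfolding psd_def by metis
    moreover have "map_mat f A $$ (i, j) = complex_of_real (F (a i j))" if "i < N" "j < N" for i j
      using carr that by (simp add: f_def a_def)
    ultimately show "psd_mat N (map_mat f A)"
      using psd_mat_iff_psd[of "map_mat f A" N "\<lambda>i j. F (a i j)"] carr by simp
  qed
  moreover have "\<forall>x>0. summable (\<lambda>M. if M > n (N - 1) then b M * x ^ M else 0) \<and>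
      f (complex_of_real x) = complex_of_real
        ((\<Sum>i<N. c (n i) * x ^ n i) + (\<Sum>M. if M > n (N - 1) then b M * x ^ M else 0))"
    using f_eq summ unfolding series by simp
  moreover have "\<forall>M > n (N - 1). sgn (b M) = real_of_int (\<epsilon> M)"
    using b(3) unfolding K_def by blast
  ultimately show ?thesis by blast
qed

end
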